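(* Let $J_0$ be a real symmetric $2$-periodic Jacobi matrix with $\sigma_c(J_0)=[-d,-s]\cup[s,d]$, $0<s<d$, and let $J$ be a complex Jacobi matrix that is a compact perturbation of $J_0$, with $d_m$, $w$, $\nu$ as defined in the context. Assume that $J_0$ has pure continuous spectrum (i.e. no eigenvalues) and that $a_n^0\neq a_{n+1}^0$. Let $t\simeq0.567$ be the unique positive root of $xe^x=1$ and $$K_2(s,d)=\frac{1024\sqrt 2\,d^5}{(d-s)^5\,(d^2-s^2)^{1/2}}.$$ If $$\frac{K_2(s,d)}{1-|w(\nu)|^2}\sum_{m=1}^\infty m\,d_m<t,$$ then the complex Jacobi matrix $J$ has no discrete spectrum.
   Context: Matrices. $J_0$ is the semi-infinite tridiagonal matrix acting on $\ell^2(\mathbb{N})$, $\mathbb{N}=\{1,2,\dots\}$, by $(J_0y)_n=a^0_{n-1}y_{n-1}+b^0_ny_n+a^0_ny_{n+1}$ (with $y_0=0$), where $a^0_{n+2}=a^0_n>0$, $b^0_{n+2}=b^0_n\in\mathbb{R}$, and $a^0_0:=a^0_2$. Its continuous spectrum $\sigma_c(J_0)$ is $[-d,-s]\cup[s,d]$ with $0<s<d$ (a normalization obtained by shifting the spectral parameter; it forces $b_2^0=-b_1^0$). $J$ is the complex Jacobi matrix $(Jy)_n=a_{n-1}y_{n-1}+b_ny_n+c_ny_{n+1}$ (with $y_0=0$) with $a_n,b_n,c_n\in\mathbb{C}$, $a_nc_n\neq0$ for $n\ge 1$, such that $J-J_0$ is compact on $\ell^2(\mathbb{N})$. Perturbation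 size. $d_m:=|b^0_m-b_m|+\left|a^0_{m-1}-\dfrac{a_{m-1}c_{m-1}}{a^0_{m-1}}\right|$ for $m\ge1$, with the convention $a_0=c_0=a_0^0$ (so $d_1=|b^0_1-b_1|$). Let $\nu:=b_1^0$; the condition $a_1^0\ne a_2^0$ amounts to $|\nu|<s$. Floquet multiplier. Let $u(\lambda)=\frac{2}{d^2-s^2}\left(\lambda^2-\frac{d^2+s^2}{2}\right)$. For $\lambda\in\mathbb{C}\setminus\sigma_c(J_0)$, $w^2(\lambda)$ is the unique root $\zeta$ with $|\zeta|<1$ of $\zeta+\zeta^{-1}=2u(\lambda)$, and $|w(\lambda)|^2=|w^2(\lambda)|$. The discrete spectrum of $J$ is the set of eigenvalues of $J$ in $\mathbb{C}\setminus\sigma_c(J_0)$. *)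

theory Defs
  imports "HOL-Analysis.Analysis"
begin

text \<open>
  Sequences over \<open>{1, 2, \<dots>}\<close> are functions on \<^typ>\<open>nat\<close> that vanish at index 0; this is exactly the
  boundary convention \<open>y 0 = 0\<close> of the Jacobi matrices below.
\<close>

definition ell2 :: "(nat \<Rightarrow> complex) set" where
  "ell2 = {y. y 0 = 0 \<and> summable (\<lambda>n. (cmod (y n))\<^sup>2)}"

definition ell2_norm :: "(nat \<Rightarrow> complex) \<Rightarrow> real" where
  "ell2_norm y = sqrt (\<Sum>n. (cmod (y n))\<^sup>2)"

definition compact_operator_ell2 :: "((nat \<Rightarrow> complex) \<Rightarrow> (nat \<Rightarrow> complex)) \<Rightarrow> bool" where
  "compact_operator_ell2 T \<longleftrightarrow>
     (\<forall>x\<in>ell2. T x \<in> ell2) \<and>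
     (\<forall>x\<in>ell2. \<forall>y\<in>ell2. \<forall>\<alpha> \<beta>.
        T (\<lambda>n. \<alpha> * x n + \<beta> * y n) = (\<lambda>n. \<alpha> * T x n + \<beta> * T y n)) \<and>
     (\<forall>X :: nat \<Rightarrow> nat \<Rightarrow> complex. (\<forall>k. X k \<in> ell2 \<and> ell2_norm (X k) \<le> 1) \<longrightarrow>
        (\<exists>z\<in>ell2. \<exists>r :: nat \<Rightarrow> nat. strict_mono r \<and>
           (\<lambda>k. ell2_norm (\<lambda>n. T (X (r k)) n - z n)) \<longlonglongrightarrow> 0))"

definition eigenvalues :: "((nat \<Rightarrow> complex) \<Rightarrow> (nat \<Rightarrow> complex)) \<Rightarrow> complex set" where
  "eigenvalues T = {\<mu>. \<exists>y\<in>ell2. y \<noteq> (\<lambda>n. 0) \<and> T y = (\<lambda>n. \<mu> * y n)}"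

text \<open>
  The continuous spectrum of a bounded operator \<open>T\<close> on \<^const>\<open>ell2\<close>: \<open>T - \<mu>\<close> is injective and has
  dense range, but is not onto.
\<close>

definition continuous_spectrum :: "((nat \<Rightarrow> complex) \<Rightarrow> (nat \<Rightarrow> complex)) \<Rightarrow> complex set" where
  "continuous_spectrum T = {\<mu>.
     inj_on (\<lambda>y n. T y n - \<mu> * y n) ell2 \<and>
     (\<forall>z\<in>ell2. \<forall>\<epsilon>>0. \<exists>y\<in>ell2. ell2_norm (\<lambda>n. (T y n - \<mu> * y n) - z n) < \<epsilon>) \<and>
     (\<lambda>y n. T y n - \<mu> * y n) ` ell2 \<noteq> ell2}"

definition discrete_spectrum ::
  "((nat \<Rightarrow> complex) \<Rightarrow> (nat \<Rightarrow> complex)) \<Rightarrow> ((nat \<Rightarrow> complex) \<Rightarrow> (nat \<Rightarrow> complex)) \<Rightarrow> complex set" where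
  "discrete_spectrum T0 T = eigenvalues T - continuous_spectrum T0"

definition jacobi_op ::
  "(nat \<Rightarrow> complex) \<Rightarrow> (nat \<Rightarrow> complex) \<Rightarrow> (nat \<Rightarrow> complex) \<Rightarrow> (nat \<Rightarrow> complex) \<Rightarrow> (nat \<Rightarrow> complex)" where
  "jacobi_op a b c y n =
     (if n = 0 then 0 else a (n - 1) * y (n - 1) + b n * y n + c n * y (n + 1))"

definition real_jacobi_op ::
  "(nat \<Rightarrow> real) \<Rightarrow> (nat \<Rightarrow> real) \<Rightarrow> (nat \<Rightarrow> complex) \<Rightarrow> (nat \<Rightarrow> complex)" where
  "real_jacobi_op a b =
     jacobi_op (\<lambda>n. of_real (a n)) (\<lambda>n. of_real (b n)) (\<lambda>n. of_real (a n))"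

text \<open>Meant for \<open>m \<ge> 1\<close> only.\<close>

definition perturbation_size ::
  "(nat \<Rightarrow> real) \<Rightarrow> (nat \<Rightarrow> real) \<Rightarrow> (nat \<Rightarrow> complex) \<Rightarrow> (nat \<Rightarrow> complex) \<Rightarrow> (nat \<Rightarrow> complex) \<Rightarrow> nat \<Rightarrow> real"
where
  "perturbation_size a0 b0 a b c m =
     cmod (of_real (b0 m) - b m) +
     cmod (of_real (a0 (m - 1)) - a (m - 1) * c (m - 1) / of_real (a0 (m - 1)))"

definition floquet_u :: "real \<Rightarrow> real \<Rightarrow> complex \<Rightarrow> complex" where
  "floquet_u s d \<mu> = of_real (2 / (d\<^sup>2 - s\<^sup>2)) * (\<mu>\<^sup>2 - of_real ((d\<^sup>2 + s\<^sup>2) / 2))"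

text \<open>
  The squared multiplier \<open>w\<^sup>2(\<mu>)\<close>, meaningful for \<open>\<mu>\<close> outside \<open>[-d,-s] \<union> [s,d]\<close>. The condition
  \<open>\<zeta> \<noteq> 0\<close> is needed because \<open>inverse 0 = 0\<close>.
\<close>

definition w_sq :: "real \<Rightarrow> real \<Rightarrow> complex \<Rightarrow> complex" where
  "w_sq s d \<mu> = (THE \<zeta>. \<zeta> \<noteq> 0 \<and> cmod \<zeta> < 1 \<and> \<zeta> + inverse \<zeta> = 2 * floquet_u s d \<mu>)"

definition K2 :: "real \<Rightarrow> real \<Rightarrow> real" where
  "K2 s d = 1024 * sqrt 2 * d ^ 5 / ((d - s) ^ 5 * sqrt (d\<^sup>2 - s\<^sup>2))"

end

theory Submission
  imports Defs
begin

text \<open>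
  Write \<open>\<zeta> = w\<^sup>2(\<mu>)\<close> for the Floquet multiplier at \<open>\<mu>\<close>, \<open>p\<close> for the solution of the periodic equation with
  \<open>p 0 = 0\<close>, \<open>p 1 = 1\<close>, and \<open>\<phi>\<close> for the Weyl solution, which decays like \<open>\<zeta>\<^sup>k\<close>. If \<open>\<bar>\<zeta>\<bar> = 1\<close>, then
  \<open>\<mu>\<close> is in the continuous spectrum: finitely supported vectors orthogonal to \<open>p\<close> lie in the range,
  and they are dense because \<open>p\<close>, not being an eigenvector, is not square-summable. If \<open>\<bar>\<zeta>\<bar> < 1\<close>, then
  the Green function inverts \<open>J\<^sub>0 - \<mu>\<close>. Comparing the resulting bands with the given ones yields
  \<open>b\<^sub>2 = - b\<^sub>1\<close>, \<open>d\<^sup>2 = \<nu>\<^sup>2 + (a\<^sub>1 + a\<^sub>2)\<^sup>2\<close> and \<open>s\<^sup>2 = \<nu>\<^sup>2 + (a\<^sub>1 - a\<^sub>2)\<^sup>2\<close>; absence of eigenvalues forces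
  \<open>a\<^sub>2 < a\<^sub>1\<close>, and then \<open>w\<^sup>2(\<nu>) = - a\<^sub>2 / a\<^sub>1\<close>.

  For an eigenvector of \<open>J\<close>, a diagonal gauge replaces the two off-diagonals \<open>a, c\<close> by
  \<open>a c / a\<^sup>0, a\<^sup>0\<close>. The Green function satisfies \<open>\<bar>G(n, k)\<bar> \<le> C min(n, k)\<close> with
  \<open>C = 2 d / (a\<^sub>2 (a\<^sub>1 - a\<^sub>2)) \<le> K\<^sub>2 / (1 - \<bar>w(\<nu>)\<bar>\<^sup>2)\<close>, so the eigenvector equation is a contraction in a
  supremum norm, already when the left-hand side of the smallness condition is below \<open>1 > t\<close>.
\<close>

section \<open>Square-summable sequences\<close>

lemma power2_norm_add_le:
  fixes x y :: complex
  shows "(cmod (x + y))\<^sup>2 \<le> 2 * (cmod x)\<^sup>2 + 2 * (cmod y)\<^sup>2"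
proof -
  have "(cmod (x + y))\<^sup>2 \<le> (cmod x + cmod y)\<^sup>2"
    by (intro power_mono norm_triangle_ineq) auto
  also have "\<dots> \<le> 2 * (cmod x)\<^sup>2 + 2 * (cmod y)\<^sup>2"
    using sum_squares_bound[of "cmod x" "cmod y"] by (simp add: power2_sum)
  finally show ?thesis .
qed

lemma summable_norm_power2_add:
  fixes x y :: "nat \<Rightarrow> complex"
  assumes "summable (\<lambda>n. (cmod (x n))\<^sup>2)" "summable (\<lambda>n. (cmod (y n))\<^sup>2)"
  shows "summable (\<lambda>n. (cmod (x n + y n))\<^sup>2)"
proof (rule summable_comparison_test')
  show "summable (\<lambda>n. 2 * (cmod (x n))\<^sup>2 + 2 * (cmod (y n))\<^sup>2)"
    using assms by (intro summable_add summable_mult)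
qed (use power2_norm_add_le in auto)

lemma summable_norm_power2_bounded_mult:
  fixes x y :: "nat \<Rightarrow> complex"
  assumes "\<And>n. cmod (c n) \<le> B" "summable (\<lambda>n. (cmod (x n))\<^sup>2)"
  shows "summable (\<lambda>n. (cmod (c n * x n))\<^sup>2)"
proof (rule summable_comparison_test')
  show "summable (\<lambda>n. B\<^sup>2 * (cmod (x n))\<^sup>2)"
    using assms(2) by (rule summable_mult)
  show "norm ((cmod (c n * x n))\<^sup>2) \<le> B\<^sup>2 * (cmod (x n))\<^sup>2" for n
    using assms(1)[of n] by (auto simp: norm_mult power_mult_distrib intro!: mult_right_mono power_mono)
qed

lemma ell2_finite_support:
  assumes "y 0 = 0" "\<And>n. n \<ge> N \<Longrightarrow> y n = 0"
  shows "y \<in> ell2"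
proof -
  have "summable (\<lambda>n. (cmod (y n))\<^sup>2)"
    by (rule summable_finite[of "{..<N}"]) (use assms in \<open>auto simp: not_less\<close>)
  then show ?thesis using assms by (simp add: ell2_def)
qed

lemma ell2_add: "x \<in> ell2 \<Longrightarrow> y \<in> ell2 \<Longrightarrow> (\<lambda>n. x n + y n) \<in> ell2"
  by (simp add: ell2_def summable_norm_power2_add)

lemma ell2_cmult: "x \<in> ell2 \<Longrightarrow> (\<lambda>n. \<alpha> * x n) \<in> ell2"
  using summable_norm_power2_bounded_mult[of "\<lambda>_. \<alpha>" "cmod \<alpha>" x] by (simp add: ell2_def)

lemma ell2_diff: "x \<in> ell2 \<Longrightarrow> y \<in> ell2 \<Longrightarrow> (\<lambda>n. x n - y n) \<in> ell2"
  using ell2_add[OF _ ell2_cmult[of y "-1"]] by simp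

lemma norm_le_ell2_norm:
  assumes "x \<in> ell2"
  shows "cmod (x n) \<le> ell2_norm x"
proof -
  have "sum (\<lambda>n. (cmod (x n))\<^sup>2) {n} \<le> (\<Sum>n. (cmod (x n))\<^sup>2)"
    using assms by (intro sum_le_suminf) (auto simp: ell2_def)
  then show ?thesis
    unfolding ell2_norm_def by (intro real_le_rsqrt) simp
qed

lemma ell2_tendsto_zero:
  assumes "x \<in> ell2"
  shows "x \<longlonglongrightarrow> 0"
proof -
  have "(\<lambda>n. sqrt ((cmod (x n))\<^sup>2)) \<longlonglongrightarrow> sqrt 0"
    using assms by (intro tendsto_real_sqrt summable_LIMSEQ_zero) (auto simp: ell2_def)
  then show ?thesis by (simp add: tendsto_norm_zero_iff)
qed

section \<open>Square-summability for geometrically damped recursions\<close>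

lemma convex_square_le:
  fixes q u v :: real
  assumes "0 < q" "q < 1"
  shows "(q * u + v)\<^sup>2 \<le> q * u\<^sup>2 + v\<^sup>2 / (1 - q)"
proof -
  \<comment> \<open>Convexity of the square at \<open>q * u + (1 - q) * (v / (1 - q))\<close>, with
    the defect written as a multiple of a square.\<close>
  have "q * u\<^sup>2 + v\<^sup>2 / (1 - q) - (q * u + v)\<^sup>2 = q / (1 - q) * ((1 - q) * u - v)\<^sup>2"
    using assms by (simp add: divide_simps) (simp add: power2_eq_square algebra_simps)
  moreover have "\<dots> \<ge> 0" using assms by simp
  ultimately show ?thesis by linarith
qed

text \<open>By convexity the partial sum of the squares of \<open>A\<close> is at most q times
  itself plus a bound independent of \<open>N\<close>; since q < 1, it can be absorbed into the
  left-hand side.\<close>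

lemma summable_power2_forward_recursion:
  fixes A w :: "nat \<Rightarrow> real"
  assumes q: "0 < q" "q < 1" and w: "summable (\<lambda>n. (w n)\<^sup>2)"
    and rec: "\<And>n. A (Suc n) = q * A n + w (Suc n)"
  shows "summable (\<lambda>n. (A n)\<^sup>2)"
proof (rule bounded_imp_summable)
  let ?Z = "(\<Sum>n. (w n)\<^sup>2) / (1 - q)"
  fix N
  have "(\<Sum>n\<le>N. (A n)\<^sup>2) \<le> (A 0)\<^sup>2 + q * (\<Sum>n\<le>N. (A n)\<^sup>2) + (\<Sum>n\<le>N. (w n)\<^sup>2) / (1 - q)"
  proof (induction N)
    case 0
    then show ?case using q by simp
  next
    case (Suc N)
    have "(\<Sum>n\<le>Suc N. (A n)\<^sup>2) \<le> (A 0)\<^sup>2 + (\<Sum>n\<le>N. q * (A n)\<^sup>2 + (w (Suc n))\<^sup>2 / (1 - q))"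
      unfolding sum.atMost_Suc_shift rec
      by (intro add_left_mono sum_mono convex_square_le[OF q])
    also have "\<dots> = (A 0)\<^sup>2 + q * (\<Sum>n\<le>N. (A n)\<^sup>2) + (\<Sum>n\<le>N. (w (Suc n))\<^sup>2) / (1 - q)"
      by (simp add: sum.distrib sum_distrib_left sum_divide_distrib)
    also have "\<dots> \<le> (A 0)\<^sup>2 + q * (\<Sum>n\<le>Suc N. (A n)\<^sup>2) + (\<Sum>n\<le>Suc N. (w n)\<^sup>2) / (1 - q)"
      using q unfolding sum.atMost_Suc_shift[of "\<lambda>n. (w n)\<^sup>2"]
      by (intro add_mono mult_left_mono divide_right_mono) auto
    finally show ?case .
  qed
  moreover have "(\<Sum>n\<le>N. (w n)\<^sup>2) / (1 - q) \<le> ?Z"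
    using q w by (intro divide_right_mono sum_le_suminf) auto
  ultimately have "(1 - q) * (\<Sum>n\<le>N. (A n)\<^sup>2) \<le> (A 0)\<^sup>2 + ?Z"
    by (simp add: algebra_simps)
  then show "(\<Sum>n\<le>N. (A n)\<^sup>2) \<le> ((A 0)\<^sup>2 + ?Z) / (1 - q)"
    using q by (simp add: pos_le_divide_eq mult.commute)
qed simp

text \<open>The same absorption, run backwards: the shifted partial sum contains the extra square of
  \<open>B (Suc N)\<close>, which the a priori bound \<open>M\<close> controls. Boundedness excludes
  homogeneous solutions growing like 1/q^n.\<close>

lemma summable_power2_backward_recursion:
  fixes B w :: "nat \<Rightarrow> real"
  assumes q: "0 < q" "q < 1" and w: "summable (\<lambda>n. (w n)\<^sup>2)"
    and rec: "\<And>n. B n = q * B (Suc n) + w n" and bound: "\<And>n. \<bar>B n\<bar> \<le> M"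
  shows "summable (\<lambda>n. (B n)\<^sup>2)"
proof (rule bounded_imp_summable)
  let ?Z = "(\<Sum>n. (w n)\<^sup>2) / (1 - q)"
  fix N
  have "(\<Sum>n\<le>N. (B n)\<^sup>2) \<le> (\<Sum>n\<le>N. q * (B (Suc n))\<^sup>2 + (w n)\<^sup>2 / (1 - q))"
    by (subst rec) (intro sum_mono convex_square_le[OF q])
  also have "\<dots> = q * (\<Sum>n\<le>N. (B (Suc n))\<^sup>2) + (\<Sum>n\<le>N. (w n)\<^sup>2) / (1 - q)"
    by (simp add: sum.distrib sum_distrib_left sum_divide_distrib)
  also have "(\<Sum>n\<le>N. (B (Suc n))\<^sup>2) \<le> (\<Sum>n\<le>Suc N. (B n)\<^sup>2)"
    unfolding sum.atMost_Suc_shift by simp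
  also have "\<dots> \<le> (\<Sum>n\<le>N. (B n)\<^sup>2) + M\<^sup>2"
    using bound[of "Suc N"] by (simp add: abs_le_square_iff[symmetric])
  also have "(\<Sum>n\<le>N. (w n)\<^sup>2) / (1 - q) \<le> ?Z"
    using q w by (intro divide_right_mono sum_le_suminf) auto
  finally have "(1 - q) * (\<Sum>n\<le>N. (B n)\<^sup>2) \<le> q * M\<^sup>2 + ?Z"
    using q by (simp add: algebra_simps)
  then show "(\<Sum>n\<le>N. (B n)\<^sup>2) \<le> (q * M\<^sup>2 + ?Z) / (1 - q)"
    using q by (simp add: pos_le_divide_eq mult.commute)
qed simp

section \<open>Periodic Jacobi matrices\<close>

locale periodic_jacobi =
  fixes a0 b0 :: "nat \<Rightarrow> real"
  assumes a0_pos: "n \<ge> 1 \<Longrightarrow> a0 n > 0"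
    and a0_periodic: "n \<ge> 1 \<Longrightarrow> a0 (n + 2) = a0 n"
    and b0_periodic: "n \<ge> 1 \<Longrightarrow> b0 (n + 2) = b0 n"
    and a0_zero: "a0 0 = a0 2"
begin

lemma a0_even: "a0 (2 * k) = a0 2"
proof (induction k)
  case (Suc k)
  then show ?case using a0_periodic[of "2 * k"] a0_zero by (cases "k = 0") auto
qed (simp add: a0_zero)

lemma a0_odd: "a0 (Suc (2 * k)) = a0 1"
proof (induction k)
  case (Suc k)
  then show ?case using a0_periodic[of "Suc (2 * k)"] by simp
qed simp

lemma b0_odd: "b0 (Suc (2 * k)) = b0 1"
proof (induction k)
  case (Suc k)
  then show ?case using b0_periodic[of "Suc (2 * k)"] by simp
qed simp

lemma b0_even: "b0 (Suc (Suc (2 * k))) = b0 2"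
proof (induction k)
  case (Suc k)
  then show ?case using b0_periodic[of "Suc (Suc (2 * k))"] by simp
qed (simp add: numeral_2_eq_2)

lemma a0_cases: "a0 n = a0 1 \<or> a0 n = a0 2"
proof (cases "even n")
  case True then show ?thesis using a0_even by (auto elim!: evenE)
next
  case False then show ?thesis using a0_odd by (auto elim!: oddE)
qed

lemma a0_pos': "a0 n > 0"
  using a0_cases[of n] a0_pos[of 1] a0_pos[of 2] by auto

lemma b0_cases: "b0 (Suc n) = b0 1 \<or> b0 (Suc n) = b0 2"
proof (cases "even n")
  case True then show ?thesis using b0_odd by (auto elim!: evenE)
next
  case False then show ?thesis using b0_even by (auto elim!: oddE)
qed

text \<open>Row \<open>Suc n\<close> of the matrix minus \<mu>, labelled by its left neighbour. No
  boundary condition is built in: \<open>y 0\<close> is free and enters with weight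
  \<open>a0 0 = a0 2\<close>, so solutions with \<open>y 0 \<noteq> 0\<close> count as homogeneous
  too.\<close>

definition residual :: "complex \<Rightarrow> (nat \<Rightarrow> complex) \<Rightarrow> nat \<Rightarrow> complex" where
  "residual \<mu> y n = of_real (a0 n) * y n + (of_real (b0 (Suc n)) - \<mu>) * y (Suc n)
     + of_real (a0 (Suc n)) * y (Suc (Suc n))"

lemma real_jacobi_op_0: "real_jacobi_op a0 b0 y 0 = 0"
  by (simp add: real_jacobi_op_def jacobi_op_def)

lemma real_jacobi_op_Suc:
  "real_jacobi_op a0 b0 y (Suc n) = residual \<mu> y n + \<mu> * y (Suc n)"
  by (simp add: real_jacobi_op_def jacobi_op_def residual_def algebra_simps)

lemma residual_diff: "residual \<mu> (\<lambda>n. x n - y n) n = residual \<mu> x n - residual \<mu> y n"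
  by (simp add: residual_def algebra_simps)

lemma residual_cmult: "residual \<mu> (\<lambda>n. \<alpha> * x n) n = \<alpha> * residual \<mu> x n"
  by (simp add: residual_def algebra_simps)

lemma residual_eq_iff_next:
  "residual \<mu> y n = g \<longleftrightarrow>
     y (Suc (Suc n)) = (g - of_real (a0 n) * y n - (of_real (b0 (Suc n)) - \<mu>) * y (Suc n))
       / of_real (a0 (Suc n))"
  using a0_pos'[of "Suc n"] by (auto simp: residual_def field_simps)

lemma real_jacobi_op_ell2:
  assumes "y \<in> ell2"
  shows "(\<lambda>n. real_jacobi_op a0 b0 y n - \<mu> * y n) \<in> ell2"
proof -
  have y: "y 0 = 0" "summable (\<lambda>n. (cmod (y n))\<^sup>2)"
    using assms by (auto simp: ell2_def)
  then have y1: "summable (\<lambda>n. (cmod (y (Suc n)))\<^sup>2)"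
    by (subst summable_Suc_iff[where f="\<lambda>n. (cmod (y n))\<^sup>2"])
  then have y2: "summable (\<lambda>n. (cmod (y (Suc (Suc n))))\<^sup>2)"
    by (subst summable_Suc_iff[where f="\<lambda>n. (cmod (y (Suc n)))\<^sup>2"])
  have a: "cmod (of_real (a0 n)) \<le> max (a0 1) (a0 2)" for n
    using a0_cases[of n] a0_pos'[of n] by auto
  have b: "cmod (of_real (b0 (Suc n)) - \<mu>) \<le> max (cmod (of_real (b0 1) - \<mu>)) (cmod (of_real (b0 2) - \<mu>))" for n
    using b0_cases[of n] by auto
  have "summable (\<lambda>n. (cmod (residual \<mu> y n))\<^sup>2)"
    unfolding residual_def
    by (intro summable_norm_power2_add summable_norm_power2_bounded_mult[OF a y(2)]
        summable_norm_power2_bounded_mult[OF a y2] summable_norm_power2_bounded_mult[OF b y1])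
  then have "summable (\<lambda>n. (cmod (real_jacobi_op a0 b0 y (Suc n) - \<mu> * y (Suc n)))\<^sup>2)"
    by (simp add: real_jacobi_op_Suc[of _ _ \<mu>])
  then show ?thesis
    using y(1) by (simp add: ell2_def real_jacobi_op_0 summable_Suc_iff[where f="\<lambda>n. (cmod (real_jacobi_op a0 b0 y n - \<mu> * y n))\<^sup>2"])
qed

section \<open>Wronskians and the discrete Green identity\<close>

lemma wronskian_step:
  assumes "residual \<mu> x n = 0" "residual \<mu> y n = g"
  shows "of_real (a0 (Suc n)) * (x (Suc n) * y (Suc (Suc n)) - x (Suc (Suc n)) * y (Suc n))
    = of_real (a0 n) * (x n * y (Suc n) - x (Suc n) * y n) + x (Suc n) * g"
proof -
  have "of_real (a0 (Suc n)) * y (Suc (Suc n))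
      = g - of_real (a0 n) * y n - (of_real (b0 (Suc n)) - \<mu>) * y (Suc n)"
    using assms(2) by (auto simp: residual_def)
  moreover have "of_real (a0 (Suc n)) * x (Suc (Suc n))
      = - of_real (a0 n) * x n - (of_real (b0 (Suc n)) - \<mu>) * x (Suc n)"
    using assms(1) by (auto simp: residual_def algebra_simps eq_neg_iff_add_eq_0)
  ultimately have "x (Suc n) * (of_real (a0 (Suc n)) * y (Suc (Suc n)))
      - (of_real (a0 (Suc n)) * x (Suc (Suc n))) * y (Suc n)
    = of_real (a0 n) * (x n * y (Suc n) - x (Suc n) * y n) + x (Suc n) * g"
    by (simp only:) (simp add: algebra_simps)
  then show ?thesis by (simp add: algebra_simps)
qed

text \<open>The weighted Wronskian changes at each step only by the source times \<open>x\<close>,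
  so the steps telescope. The boundary weight is \<open>a0 2\<close> because
  \<open>a0 0 = a0 2\<close>.\<close>

lemma wronskian_sum:
  assumes "\<And>n. residual \<mu> x n = 0" "\<And>n. residual \<mu> y n = f (Suc n)"
  shows "of_real (a0 n) * (x n * y (Suc n) - x (Suc n) * y n)
    = of_real (a0 2) * (x 0 * y 1 - x 1 * y 0) + (\<Sum>k=1..n. x k * f k)"
proof (induction n)
  case 0
  then show ?case by (simp add: a0_zero)
next
  case (Suc n)
  then show ?case using wronskian_step[OF assms(1)[of n] assms(2)[of n]]
    by (simp add: sum.atLeast_Suc_atMost_Suc_shift add.assoc)
qed

end

section \<open>Floquet solutions\<close>

text \<open>
  The characteristic equation says that \<open>\<zeta>\<close> is a Floquet multiplier at \<open>\<mu>\<close>: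
  \<open>\<zeta> + 1 / \<zeta> = ((\<mu> - b\<^sub>1)(\<mu> - b\<^sub>2) - a\<^sub>1\<^sup>2 - a\<^sub>2\<^sup>2) / (a\<^sub>1 a\<^sub>2)\<close>.
\<close>

locale floquet = periodic_jacobi +
  fixes \<mu> \<zeta> :: complex
  assumes zeta_nz: "\<zeta> \<noteq> 0"
    and char_eq: "(\<mu> - of_real (b0 1)) * (\<mu> - of_real (b0 2)) * \<zeta>
      = (of_real (a0 1) + of_real (a0 2) * \<zeta>) * (of_real (a0 2) + of_real (a0 1) * \<zeta>)"
begin

text \<open>Two sites multiply the values by \<zeta>. The two starting values are scaled so that no
  division occurs: the residual at odd \<open>n\<close> then vanishes identically, and at even
  \<open>n\<close> it vanishes by the characteristic equation.\<close>

definition weyl :: "nat \<Rightarrow> complex" where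
  "weyl n = \<zeta> ^ (n div 2) *
     (if even n then of_real (a0 1) + of_real (a0 2) * \<zeta> else (\<mu> - of_real (b0 2)) * \<zeta>)"

text \<open>This is (\<zeta>^k - \<zeta>^(-k)) / (\<zeta> - 1/\<zeta>), the Chebyshev polynomial of
  the second kind of degree k - 1 at (\<zeta> + 1/\<zeta>)/2. The recursive form also covers \<zeta>
  = 1 and \<zeta> = -1, where the quotient is 0/0.\<close>

primrec cheb :: "nat \<Rightarrow> complex" where
  "cheb 0 = 0"
| "cheb (Suc k) = \<zeta> ^ k + cheb k / \<zeta>"

text \<open>Closed form of the solution p from the overview; it reduces all growth estimates for p
  to estimates for \<open>cheb\<close>.\<close>

definition dirichlet :: "nat \<Rightarrow> complex" where
  "dirichlet n = (if even n then (\<mu> - of_real (b0 1)) / of_real (a0 1) * cheb (n div 2)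
     else cheb (Suc (n div 2)) + of_real (a0 2 / a0 1) * cheb (n div 2))"

lemma weyl_even: "weyl (2 * k) = \<zeta> ^ k * (of_real (a0 1) + of_real (a0 2) * \<zeta>)"
  by (simp add: weyl_def)

lemma weyl_odd: "weyl (Suc (2 * k)) = \<zeta> ^ k * ((\<mu> - of_real (b0 2)) * \<zeta>)"
  by (simp add: weyl_def)

lemma dirichlet_even: "dirichlet (2 * k) = (\<mu> - of_real (b0 1)) / of_real (a0 1) * cheb k"
  by (simp add: dirichlet_def)

lemma dirichlet_odd: "dirichlet (Suc (2 * k)) = cheb (Suc k) + of_real (a0 2 / a0 1) * cheb k"
  by (simp add: dirichlet_def del: cheb.simps)

lemma dirichlet_0 [simp]: "dirichlet 0 = 0" and dirichlet_1 [simp]: "dirichlet (Suc 0) = 1"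
  by (simp_all add: dirichlet_def)

lemma a0_nz: "of_real (a0 n) \<noteq> (0 :: complex)"
  using a0_pos'[of n] by simp

lemma cheb_rec: "cheb (Suc (Suc k)) + cheb k = (\<zeta> + 1 / \<zeta>) * cheb (Suc k)"
proof (induction k)
  case (Suc k)
  then show ?case using zeta_nz by (simp add: field_simps)
qed (use zeta_nz in simp)

lemma char_eq': "(\<mu> - of_real (b0 1)) * (\<mu> - of_real (b0 2))
    = of_real (a0 1) * of_real (a0 2) * (\<zeta> + 1 / \<zeta>) + (of_real (a0 1))\<^sup>2 + (of_real (a0 2))\<^sup>2"
proof -
  have "(\<mu> - of_real (b0 1)) * (\<mu> - of_real (b0 2)) * \<zeta> / \<zeta>
    = of_real (a0 1) * of_real (a0 2) * (\<zeta> + 1 / \<zeta>) + (of_real (a0 1))\<^sup>2 + (of_real (a0 2))\<^sup>2"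
    unfolding char_eq using zeta_nz by (simp add: divide_simps) (simp add: power2_eq_square algebra_simps)
  then show ?thesis using zeta_nz by simp
qed

lemma parity_cases: obtains k where "n = 2 * k" | k where "n = Suc (2 * k)"
  by (metis evenE oddE Suc_eq_plus1)

lemma residual_weyl: "residual \<mu> weyl n = 0"
proof (cases rule: parity_cases[of n])
  case (1 k)
  have "weyl (Suc (Suc (2 * k))) = \<zeta> ^ Suc k * (of_real (a0 1) + of_real (a0 2) * \<zeta>)"
    using weyl_even[of "Suc k"] by simp
  then have "residual \<mu> weyl n = \<zeta> ^ k * ((of_real (a0 1) + of_real (a0 2) * \<zeta>) * (of_real (a0 2) + of_real (a0 1) * \<zeta>)
     - (\<mu> - of_real (b0 1)) * (\<mu> - of_real (b0 2)) * \<zeta>)"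
    unfolding residual_def 1 weyl_even weyl_odd a0_even a0_odd b0_odd by (simp add: algebra_simps)
  then show ?thesis by (simp only: char_eq) simp
next
  case (2 k)
  have *: "weyl (Suc (Suc (2 * k))) = \<zeta> ^ Suc k * (of_real (a0 1) + of_real (a0 2) * \<zeta>)"
    "weyl (Suc (Suc (Suc (2 * k)))) = \<zeta> ^ Suc k * ((\<mu> - of_real (b0 2)) * \<zeta>)"
    "a0 (Suc (Suc (2 * k))) = a0 2"
    using weyl_even[of "Suc k"] weyl_odd[of "Suc k"] a0_even[of "Suc k"] by simp_all
  then show ?thesis
    unfolding residual_def 2 * weyl_odd a0_odd b0_even by (simp add: algebra_simps)
qed

lemma residual_dirichlet: "residual \<mu> dirichlet n = 0"
proof (cases rule: parity_cases[of n])
  case (1 k)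
  have *: "dirichlet (Suc (Suc (2 * k))) = (\<mu> - of_real (b0 1)) / of_real (a0 1) * cheb (Suc k)"
    using dirichlet_even[of "Suc k"] by simp
  then show ?thesis
    unfolding residual_def 1 * dirichlet_even dirichlet_odd a0_even a0_odd b0_odd using a0_nz[of 1]
    by (simp add: field_simps del: cheb.simps)
next
  case (2 k)
  have *: "dirichlet (Suc (Suc (2 * k))) = (\<mu> - of_real (b0 1)) / of_real (a0 1) * cheb (Suc k)"
    "dirichlet (Suc (Suc (Suc (2 * k)))) = cheb (Suc (Suc k)) + of_real (a0 2 / a0 1) * cheb (Suc k)"
    "a0 (Suc (Suc (2 * k))) = a0 2"
    using dirichlet_even[of "Suc k"] dirichlet_odd[of "Suc k"] a0_even[of "Suc k"]
    by (simp_all del: cheb.simps)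
  have "of_real (a0 1) * residual \<mu> dirichlet n
     = of_real (a0 1) * of_real (a0 2) * (cheb (Suc (Suc k)) + cheb k)
       + ((of_real (a0 1))\<^sup>2 + (of_real (a0 2))\<^sup>2 - (\<mu> - of_real (b0 1)) * (\<mu> - of_real (b0 2))) * cheb (Suc k)"
    unfolding residual_def 2 * dirichlet_odd a0_odd b0_even using a0_nz[of 1]
    by (simp add: field_simps power2_eq_square del: cheb.simps)
  also have "\<dots> = 0"
    unfolding cheb_rec char_eq' by (simp add: algebra_simps del: cheb.simps)
  finally show ?thesis using a0_nz[of 1] by simp
qed

text \<open>The Wronskian of two homogeneous solutions is constant, so it can be read off at 0. It
  is the denominator of the Green function, which is why \<open>weyl 0 \<noteq> 0\<close> is
  required later.\<close>

lemma wronskian_dirichlet_weyl: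
  "of_real (a0 n) * (dirichlet n * weyl (Suc n) - dirichlet (Suc n) * weyl n) = - of_real (a0 2) * weyl 0"
  using wronskian_sum[of \<mu> dirichlet weyl "\<lambda>_. 0" n] residual_dirichlet residual_weyl by simp

lemma weyl_0: "weyl 0 = of_real (a0 1) + of_real (a0 2) * \<zeta>"
  by (simp add: weyl_def)

text \<open>The product of \<zeta>^k and \<open>cheb (Suc k)\<close> is the geometric sum of the
  powers of \<zeta>^2 up to k. The right-hand side can be bounded by a constant when the modulus of
  \<zeta> is below 1, or by k + 1 uniformly up to the unit circle.\<close>

lemma norm_cheb_le: "cmod \<zeta> ^ k * cmod (cheb (Suc k)) \<le> (\<Sum>j\<le>k. (cmod \<zeta> ^ 2) ^ j)"
proof (induction k)
  case (Suc k)
  let ?r = "cmod \<zeta>"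
  have "?r ^ Suc k * cmod (cheb (Suc (Suc k))) \<le> ?r ^ Suc k * (?r ^ Suc k + cmod (cheb (Suc k)) / ?r)"
    using norm_triangle_ineq[of "\<zeta> ^ Suc k" "cheb (Suc k) / \<zeta>"]
    unfolding cheb.simps(2)[of "Suc k"]
    by (intro mult_left_mono) (simp_all add: norm_power norm_divide norm_mult del: cheb.simps)
  also have "\<dots> = (?r ^ 2) ^ Suc k + ?r ^ k * cmod (cheb (Suc k))"
    using zeta_nz by (simp add: field_simps power_mult_distrib power2_eq_square del: cheb.simps)
  also have "\<dots> \<le> (\<Sum>j\<le>Suc k. (?r ^ 2) ^ j)"
    using Suc.IH by simp
  finally show ?case .
qed simp

lemma norm_cheb_le_linear:
  assumes "cmod \<zeta> \<le> 1"
  shows "cmod \<zeta> ^ k * cmod (cheb k) \<le> cmod \<zeta> * real k"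
proof (cases k)
  case (Suc i)
  have "cmod \<zeta> ^ i * cmod (cheb (Suc i)) \<le> (\<Sum>j\<le>i. (cmod \<zeta> ^ 2) ^ j)"
    by (rule norm_cheb_le)
  also have "\<dots> \<le> (\<Sum>j\<le>i. 1)"
    using assms by (intro sum_mono power_le_one) auto
  finally have "cmod \<zeta> * (cmod \<zeta> ^ i * cmod (cheb (Suc i))) \<le> cmod \<zeta> * real (Suc i)"
    by (intro mult_left_mono) auto
  then show ?thesis by (simp add: Suc mult.assoc del: cheb.simps)
qed simp

end

section \<open>Spectrum of the periodic matrix\<close>

context periodic_jacobi
begin

fun inhom_solution :: "complex \<Rightarrow> (nat \<Rightarrow> complex) \<Rightarrow> nat \<Rightarrow> complex" where
  "inhom_solution \<mu> f 0 = 0"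
| "inhom_solution \<mu> f (Suc 0) = 0"
| "inhom_solution \<mu> f (Suc (Suc n)) =
     (f (Suc n) - of_real (a0 n) * inhom_solution \<mu> f n - (of_real (b0 (Suc n)) - \<mu>) * inhom_solution \<mu> f (Suc n))
       / of_real (a0 (Suc n))"

lemma residual_inhom_solution: "residual \<mu> (inhom_solution \<mu> f) n = f (Suc n)"
  by (simp add: residual_eq_iff_next)

text \<open>Membership in \<open>ell2\<close> includes \<open>y 0 = 0\<close>, so a nonzero
  homogeneous solution there would be an eigenvector.\<close>

lemma residual_eq_0_imp_zero:
  assumes "y \<in> ell2" "\<And>n. residual \<mu> y n = 0" "eigenvalues (real_jacobi_op a0 b0) = {}"
  shows "y n = 0"
proof (rule ccontr)
  assume "y n \<noteq> 0"
  then have "y \<noteq> (\<lambda>n. 0)" by auto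
  moreover have "real_jacobi_op a0 b0 y m = \<mu> * y m" for m
    using assms(1,2) by (cases m) (auto simp: ell2_def real_jacobi_op_0 real_jacobi_op_Suc[of _ _ \<mu>])
  ultimately have "\<mu> \<in> eigenvalues (real_jacobi_op a0 b0)"
    using assms(1) by (auto simp: eigenvalues_def)
  with assms(3) show False by simp
qed

lemma inj_on_if_no_eigenvalues:
  assumes "eigenvalues (real_jacobi_op a0 b0) = {}"
  shows "inj_on (\<lambda>y n. real_jacobi_op a0 b0 y n - \<mu> * y n) ell2"
proof (rule inj_onI)
  fix x y
  assume xy: "x \<in> ell2" "y \<in> ell2"
    and eq: "(\<lambda>n. real_jacobi_op a0 b0 x n - \<mu> * x n) = (\<lambda>n. real_jacobi_op a0 b0 y n - \<mu> * y n)"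
  have "residual \<mu> x n = residual \<mu> y n" for n
    using fun_cong[OF eq, of "Suc n"] by (simp add: real_jacobi_op_Suc[of _ _ \<mu>])
  then have "x n - y n = 0" for n
    using residual_eq_0_imp_zero[OF ell2_diff[OF xy], of \<mu>] assms by (simp add: residual_diff)
  then show "x = y" by auto
qed

end

context floquet
begin

section \<open>Dense range, and failure of surjectivity at unimodular multipliers\<close>

lemma dirichlet_not_summable:
  assumes "eigenvalues (real_jacobi_op a0 b0) = {}"
  shows "\<not> summable (\<lambda>n. (cmod (dirichlet n))\<^sup>2)"
  using residual_eq_0_imp_zero[of dirichlet \<mu> 1] residual_dirichlet assms
  by (auto simp: ell2_def)

text \<open>
  By the Wronskian, the solution started with zero data is eventually a multiple of the Dirichlet
  solution; subtracting that multiple leaves a finitely supported preimage.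
\<close>

lemma finite_support_in_range:
  assumes no_ev: "eigenvalues (real_jacobi_op a0 b0) = {}"
    and z0: "z 0 = 0" and z: "\<And>n. n > N \<Longrightarrow> z n = 0"
    and orth: "(\<Sum>k=1..N. dirichlet k * z k) = 0"
  shows "\<exists>h\<in>ell2. \<forall>n. real_jacobi_op a0 b0 h n - \<mu> * h n = z n"
proof -
  have "\<not> finite {n. dirichlet n \<noteq> 0}"
    using dirichlet_not_summable[OF no_ev] summable_finite[of "{n. dirichlet n \<noteq> 0}" "\<lambda>n. (cmod (dirichlet n))\<^sup>2"]
    by auto
  then obtain M where M: "M > N" "dirichlet M \<noteq> 0"
    by (auto simp: infinite_nat_iff_unbounded)
  let ?v = "inhom_solution \<mu> z"
  \<comment> \<open>This multiple makes \<open>h\<close> vanish at \<open>M\<close>. The vanishing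
    Wronskian then gives \<open>h (Suc M) = 0\<close>, and the recursion propagates the two zeros to
    the right.\<close>
  define c where "c = ?v M / dirichlet M"
  define h where "h n = ?v n - c * dirichlet n" for n
  have res: "residual \<mu> h n = z (Suc n)" for n
    by (simp add: h_def[abs_def] residual_diff residual_cmult residual_dirichlet residual_inhom_solution)
  have "(\<Sum>k=1..M. dirichlet k * z k) = (\<Sum>k=1..N. dirichlet k * z k)"
    using M z by (intro sum.mono_neutral_right) auto
  then have "dirichlet M * ?v (Suc M) - dirichlet (Suc M) * ?v M = 0"
    using wronskian_sum[of \<mu> dirichlet ?v z M] residual_dirichlet residual_inhom_solution orth a0_nz[of M]
    by simp
  then have hM: "h M = 0" "h (Suc M) = 0"
    using M by (auto simp: h_def c_def field_simps)
  have h0: "h (M + n) = 0 \<and> h (Suc (M + n)) = 0" for n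
  proof (induction n)
    case (Suc n)
    have "residual \<mu> h (M + n) = 0" using res z M by simp
    then show ?case using Suc.IH by (simp add: residual_eq_iff_next)
  qed (use hM in simp)
  have "h \<in> ell2"
  proof (rule ell2_finite_support)
    show "h n = 0" if "n \<ge> M" for n
      using h0[of "n - M"] that by simp
  qed (simp add: h_def)
  moreover have "real_jacobi_op a0 b0 h n - \<mu> * h n = z n" for n
    using z0 by (cases n) (simp_all add: real_jacobi_op_0 h_def[of 0] real_jacobi_op_Suc[of _ _ \<mu>] res)
  ultimately show ?thesis by blast
qed

text \<open>Cut \<open>z\<close> off to \<open>t\<close>, then subtract a multiple \<open>g\<close>
  of the conjugate of p on an initial segment, so that \<open>t - g\<close> meets the orthogonality
  condition. The squared norm of \<open>g\<close> is |S|^2 / Q(N), which is small for large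
  \<open>N\<close> because p is not square-summable.\<close>

lemma dense_range:
  assumes no_ev: "eigenvalues (real_jacobi_op a0 b0) = {}" and z: "z \<in> ell2" and "\<epsilon> > 0"
  shows "\<exists>y\<in>ell2. ell2_norm (\<lambda>n. (real_jacobi_op a0 b0 y n - \<mu> * y n) - z n) < \<epsilon>"
proof -
  let ?p = dirichlet
  have sz: "summable (\<lambda>n. (cmod (z n))\<^sup>2)" and z0: "z 0 = 0"
    using z by (auto simp: ell2_def)
  \<comment> \<open>The tail and the correction each get a quarter of the squared tolerance, because
    the squared norm of their sum is estimated by twice the sum of the squared norms.\<close>
  obtain N0 where N0: "(\<Sum>n. (cmod (z (n + Suc N0)))\<^sup>2) < \<epsilon>\<^sup>2 / 4"
  proof -
    obtain N where N: "\<And>n. n \<ge> N \<Longrightarrow> norm (\<Sum>i. (cmod (z (i + n)))\<^sup>2) < \<epsilon>\<^sup>2 / 4"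
      using suminf_exist_split[OF _ sz, of "\<epsilon>\<^sup>2 / 4"] \<open>\<epsilon> > 0\<close> by auto
    from N[of "Suc N"] show ?thesis using that[of N] by simp
  qed
  define S where "S = (\<Sum>k=1..N0. ?p k * z k)"
  define Q where "Q N = (\<Sum>k\<le>N. (cmod (?p k))\<^sup>2)" for N
  obtain N1 where "Q N1 > 4 * (cmod S)\<^sup>2 / \<epsilon>\<^sup>2 + 1"
    using dirichlet_not_summable[OF no_ev] bounded_imp_summable[of "\<lambda>k. (cmod (?p k))\<^sup>2"]
    unfolding Q_def by (meson not_le zero_le_power2)
  moreover define N where "N = max N0 N1"
  moreover have "Q N1 \<le> Q N"
    unfolding Q_def N_def by (intro sum_mono2) auto
  ultimately have Q: "Q N > 4 * (cmod S)\<^sup>2 / \<epsilon>\<^sup>2 + 1" and "N \<ge> N0" by auto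
  have "4 * (cmod S)\<^sup>2 / \<epsilon>\<^sup>2 \<ge> 0" by simp
  with Q have Qpos: "Q N > 0" by linarith
  have Q': "(cmod S)\<^sup>2 / Q N < \<epsilon>\<^sup>2 / 4"
  proof -
    have "4 * (cmod S)\<^sup>2 / \<epsilon>\<^sup>2 < Q N" using Q by linarith
    then show ?thesis using Qpos \<open>\<epsilon> > 0\<close> by (simp add: field_simps)
  qed
  define t where "t n = (if n \<le> N0 then z n else 0)" for n
  define g where "g n = (if n \<le> N then S / of_real (Q N) * cnj (?p n) else 0)" for n
  have g0: "g 0 = 0" by (simp add: g_def)
  have QN: "(\<Sum>k=1..N. ?p k * cnj (?p k)) = of_real (Q N)"
  proof -
    have "of_real (Q N) = (\<Sum>k\<le>N. ?p k * cnj (?p k))"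
      unfolding Q_def of_real_sum by (intro sum.cong) (simp_all add: complex_norm_square[symmetric])
    also have "\<dots> = (\<Sum>k=1..N. ?p k * cnj (?p k))"
      by (rule sum.mono_neutral_right) (auto simp: not_le)
    finally show ?thesis by simp
  qed
  have "(\<Sum>k=1..N. ?p k * (t k - g k)) = (\<Sum>k=1..N. ?p k * t k) - (\<Sum>k=1..N. ?p k * g k)"
    by (simp add: right_diff_distrib sum_subtractf)
  also have "(\<Sum>k=1..N. ?p k * t k) = (\<Sum>k=1..N0. ?p k * t k)"
    using \<open>N \<ge> N0\<close> by (intro sum.mono_neutral_right) (auto simp: t_def)
  also have "\<dots> = S"
    unfolding S_def t_def by (intro sum.cong) auto
  also have "(\<Sum>k=1..N. ?p k * g k) = (\<Sum>k=1..N. S / of_real (Q N) * (?p k * cnj (?p k)))"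
    by (intro sum.cong) (auto simp: g_def)
  also have "\<dots> = S"
    unfolding sum_distrib_left[symmetric] QN using Qpos by simp
  finally have "(\<Sum>k=1..N. ?p k * (t k - g k)) = 0" by simp
  then obtain h where h: "h \<in> ell2" "\<And>n. real_jacobi_op a0 b0 h n - \<mu> * h n = t n - g n"
    using finite_support_in_range[OF no_ev, of "\<lambda>n. t n - g n" N] \<open>N \<ge> N0\<close> z0 g0
    by (auto simp: t_def g_def)
  have tail: "(\<lambda>n. (cmod (t n - z n))\<^sup>2) sums (\<Sum>n. (cmod (z (n + Suc N0)))\<^sup>2)"
  proof -
    have "(\<lambda>n. (cmod (t (n + Suc N0) - z (n + Suc N0)))\<^sup>2) sums (\<Sum>n. (cmod (z (n + Suc N0)))\<^sup>2)"
      using summable_sums[OF summable_ignore_initial_segment[OF sz, of "Suc N0"]] by (simp add: t_def)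
    moreover have "(\<Sum>n<Suc N0. (cmod (t n - z n))\<^sup>2) = 0"
      by (intro sum.neutral) (auto simp: t_def)
    ultimately show ?thesis
      using sums_iff_shift[of "\<lambda>n. (cmod (t n - z n))\<^sup>2" "Suc N0"] by simp
  qed
  have gsum: "(\<lambda>n. (cmod (g n))\<^sup>2) sums ((cmod S)\<^sup>2 / Q N)"
  proof -
    have "(\<lambda>n. (cmod (g n))\<^sup>2) sums (\<Sum>n\<le>N. (cmod (g n))\<^sup>2)"
      by (rule sums_finite) (auto simp: g_def)
    also have "(\<Sum>n\<le>N. (cmod (g n))\<^sup>2) = (\<Sum>n\<le>N. (cmod S / Q N)\<^sup>2 * (cmod (?p n))\<^sup>2)"
      using Qpos by (intro sum.cong) (auto simp: g_def norm_mult norm_divide power_mult_distrib power_divide)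
    also have "\<dots> = (cmod S / Q N)\<^sup>2 * Q N"
      by (simp add: Q_def sum_distrib_left)
    also have "\<dots> = (cmod S)\<^sup>2 / Q N"
      using Qpos by (simp add: power2_eq_square)
    finally show ?thesis .
  qed
  have bound: "(cmod ((t n - g n) - z n))\<^sup>2 \<le> 2 * (cmod (t n - z n))\<^sup>2 + 2 * (cmod (g n))\<^sup>2" for n
    using power2_norm_add_le[of "t n - z n" "- g n"] by (simp add: algebra_simps)
  have major: "(\<lambda>n. 2 * (cmod (t n - z n))\<^sup>2 + 2 * (cmod (g n))\<^sup>2) sums
      (2 * (\<Sum>n. (cmod (z (n + Suc N0)))\<^sup>2) + 2 * ((cmod S)\<^sup>2 / Q N))"
    by (intro sums_add sums_mult tail gsum)
  have "(\<Sum>n. (cmod ((t n - g n) - z n))\<^sup>2) \<le> (\<Sum>n. 2 * (cmod (t n - z n))\<^sup>2 + 2 * (cmod (g n))\<^sup>2)"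
    by (intro suminf_le bound summable_comparison_test'[OF sums_summable[OF major]] sums_summable[OF major])
      (use bound in auto)
  also have "\<dots> < \<epsilon>\<^sup>2"
    unfolding sums_unique[OF major, symmetric] using N0 Q' by linarith
  finally have "ell2_norm (\<lambda>n. (real_jacobi_op a0 b0 h n - \<mu> * h n) - z n) < sqrt (\<epsilon>\<^sup>2)"
    unfolding ell2_norm_def h(2) by (rule real_sqrt_less_mono)
  then show ?thesis using h(1) \<open>\<epsilon> > 0\<close> by auto
qed

text \<open>A preimage of the first unit vector would yield a homogeneous solution that is nonzero
  at 0 and tends to 0. A unimodular multiplier rules this out: along even indices the modulus is
  constant.\<close>

lemma not_onto:
  assumes "cmod \<zeta> = 1" "y \<in> ell2"
  shows "(\<lambda>n. real_jacobi_op a0 b0 y n - \<mu> * y n) \<noteq> (\<lambda>n. if n = 1 then 1 else 0)"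
proof
  assume eq: "(\<lambda>n. real_jacobi_op a0 b0 y n - \<mu> * y n) = (\<lambda>n. if n = 1 then 1 else 0)"
  have y0: "y 0 = 0" using assms(2) by (simp add: ell2_def)
  have res: "residual \<mu> y n = (if n = 0 then 1 else 0)" for n
    using fun_cong[OF eq, of "Suc n"] by (simp add: real_jacobi_op_Suc[of _ _ \<mu>] split: if_splits)
  \<comment> \<open>Changing the boundary value turns \<open>y\<close> into a homogeneous solution.\<close>
  define v where "v = y(0 := - 1 / of_real (a0 2))"
  have rv: "residual \<mu> v n = 0" for n
    using res[of n] y0 a0_nz[of 2] by (cases n) (auto simp: v_def residual_def a0_zero algebra_simps)
  \<comment> \<open>Three consecutive rows, the middle one multiplied by
    \<open>\<mu> - b0 1\<close>, eliminate the values at odd indices and leave the recursion of the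
    period map with trace \<zeta> + 1/\<zeta>.\<close>
  have four: "v (2 * k) + v (2 * k + 4) = (\<zeta> + 1 / \<zeta>) * v (2 * k + 2)" for k
  proof -
    let ?a = "of_real (a0 1) :: complex" and ?b = "of_real (a0 2) :: complex"
    have idx: "a0 (Suc (Suc (2 * k))) = a0 2" "a0 (Suc (Suc (Suc (2 * k)))) = a0 1"
      "b0 (Suc (Suc (Suc (2 * k)))) = b0 1"
      using a0_even[of "Suc k"] a0_odd[of "Suc k"] b0_odd[of "Suc k"] by simp_all
    have e1: "(\<mu> - of_real (b0 1)) * v (Suc (2 * k)) = ?b * v (2 * k) + ?a * v (Suc (Suc (2 * k)))"
      using rv[of "2 * k"] unfolding residual_def a0_even a0_odd b0_odd
      by (simp add: algebra_simps add_eq_0_iff)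
    have e2: "(\<mu> - of_real (b0 2)) * v (Suc (Suc (2 * k))) = ?a * v (Suc (2 * k)) + ?b * v (Suc (Suc (Suc (2 * k))))"
      using rv[of "Suc (2 * k)"] unfolding residual_def a0_odd b0_even idx
      by (simp add: algebra_simps add_eq_0_iff)
    have e3: "(\<mu> - of_real (b0 1)) * v (Suc (Suc (Suc (2 * k)))) = ?b * v (Suc (Suc (2 * k))) + ?a * v (Suc (Suc (Suc (Suc (2 * k)))))"
      using rv[of "Suc (Suc (2 * k))"] unfolding residual_def idx
      by (simp add: algebra_simps add_eq_0_iff)
    have "(\<mu> - of_real (b0 1)) * (\<mu> - of_real (b0 2)) * v (Suc (Suc (2 * k)))
       = ?a * ((\<mu> - of_real (b0 1)) * v (Suc (2 * k))) + ?b * ((\<mu> - of_real (b0 1)) * v (Suc (Suc (Suc (2 * k)))))"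
      unfolding mult.assoc e2 by (simp add: algebra_simps)
    also have "\<dots> = ?a * ?b * (v (2 * k) + v (2 * k + 4)) + (?a\<^sup>2 + ?b\<^sup>2) * v (Suc (Suc (2 * k)))"
      unfolding e1 e3 by (simp add: algebra_simps power2_eq_square eval_nat_numeral)
    finally have "?a * ?b * (v (2 * k) + v (2 * k + 4)) = ?a * ?b * ((\<zeta> + 1 / \<zeta>) * v (2 * k + 2))"
      unfolding char_eq' by (simp add: algebra_simps)
    then show ?thesis using a0_nz[of 1] a0_nz[of 2] by simp
  qed
  define x where "x k = v (2 * k)" for k
  have xrec: "x (Suc (Suc k)) = (\<zeta> + 1 / \<zeta>) * x (Suc k) - x k" for k
    using four[of k] by (simp add: x_def eq_diff_eq add.commute eval_nat_numeral)
  have "(\<lambda>n. y (2 * n)) \<longlonglongrightarrow> 0"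
    using LIMSEQ_subseq_LIMSEQ[OF ell2_tendsto_zero[OF assms(2)], of "\<lambda>n. 2 * n"]
    by (simp add: strict_mono_def o_def)
  then have "(\<lambda>n. y (2 * Suc n)) \<longlonglongrightarrow> 0"
    by (rule LIMSEQ_Suc)
  then have x_lim': "(\<lambda>n. x (Suc n)) \<longlonglongrightarrow> 0"
    by (simp add: x_def v_def)
  then have x_lim: "x \<longlonglongrightarrow> 0"
    by (simp add: filterlim_sequentially_Suc)
  \<comment> \<open>A conserved quadratic form of the recursion, which factors over the multipliers.\<close>
  define E where "E k = (x (Suc k) - \<zeta> * x k) * (x (Suc k) - x k / \<zeta>)" for k
  have E_eq: "E k = (x (Suc k))\<^sup>2 - (\<zeta> + 1 / \<zeta>) * (x k * x (Suc k)) + (x k)\<^sup>2" for k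
    unfolding E_def using zeta_nz by (simp add: algebra_simps power2_eq_square)
  have form_invariant: "(\<sigma> * u - v)\<^sup>2 - \<sigma> * (u * (\<sigma> * u - v)) + u\<^sup>2 = u\<^sup>2 - \<sigma> * (v * u) + v\<^sup>2" for \<sigma> u v :: complex
    by (simp add: algebra_simps power2_eq_square)
  have "E (Suc k) = E k" for k
    unfolding E_eq xrec[of k] by (rule form_invariant)
  then have E_const: "E k = E 0" for k by (induction k) auto
  have "E \<longlonglongrightarrow> (0 - \<zeta> * 0) * (0 - 0 / \<zeta>)"
    unfolding E_def by (intro tendsto_intros x_lim x_lim' zeta_nz)
  moreover have "E = (\<lambda>_. E 0)"
    using E_const by (rule ext)
  ultimately have "E 0 = 0"
    using LIMSEQ_unique[of E 0 "E 0"] tendsto_const[of "E 0" sequentially] by simp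
  then have E0: "E k = 0" for k using E_const by simp
  \<comment> \<open>One factor of \<open>E k\<close> vanishes, possibly a different one for each
    \<open>k\<close>. Either way consecutive values differ by a unimodular factor, so the double
    multipliers 1 and -1 need no separate treatment.\<close>
  have "cmod (x (Suc k)) = cmod (x k)" for k
    using E0[of k] assms(1) by (auto simp: E_def norm_mult norm_divide)
  then have "cmod (x k) = cmod (x 0)" for k by (induction k) auto
  then have "(\<lambda>k. cmod (x k)) = (\<lambda>_. cmod (x 0))" by (rule ext)
  moreover have "(\<lambda>k. cmod (x k)) \<longlonglongrightarrow> 0"
    using x_lim by (rule tendsto_norm_zero)
  ultimately have "cmod (x 0) = 0"
    by (simp add: LIMSEQ_const_iff)
  then show False using a0_nz[of 2] by (simp add: x_def v_def)
qed

lemma unit_multiplier_imp_continuous_spectrum: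
  assumes "eigenvalues (real_jacobi_op a0 b0) = {}" "cmod \<zeta> = 1"
  shows "\<mu> \<in> continuous_spectrum (real_jacobi_op a0 b0)"
proof -
  let ?e = "\<lambda>n. if n = 1 then 1 else 0"
  have "?e \<in> ell2"
    by (rule ell2_finite_support[of _ 2]) auto
  moreover have "?e \<notin> (\<lambda>y n. real_jacobi_op a0 b0 y n - \<mu> * y n) ` ell2"
    using not_onto[OF assms(2)] by (auto simp: image_iff dest: sym)
  ultimately have "(\<lambda>y n. real_jacobi_op a0 b0 y n - \<mu> * y n) ` ell2 \<noteq> ell2"
    by blast
  then show ?thesis
    unfolding continuous_spectrum_def
    using inj_on_if_no_eigenvalues[OF assms(1)] dense_range[OF assms(1)] by blast
qed

section \<open>The Green function for multipliers inside the unit disc\<close>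

lemma norm_weyl_le:
  assumes "cmod \<zeta> < 1"
  shows "\<exists>C\<ge>0. \<forall>n. cmod (weyl n) \<le> C * sqrt (cmod \<zeta>) ^ n"
proof (intro exI conjI allI)
  let ?C = "cmod (of_real (a0 1) + of_real (a0 2) * \<zeta>) + cmod (\<mu> - of_real (b0 2))"
  let ?q = "sqrt (cmod \<zeta>)"
  have q: "?q ^ 2 = cmod \<zeta>" "0 \<le> ?q" "?q \<le> 1" using assms by auto
  show "?C \<ge> 0" by simp
  fix n
  show "cmod (weyl n) \<le> ?C * ?q ^ n"
  proof (cases rule: parity_cases[of n])
    case (1 k)
    show ?thesis unfolding 1 weyl_even power_mult q(1)
      by (simp add: norm_mult norm_power mult.commute mult_left_mono)
  next
    case (2 k)
    have "cmod \<zeta> \<le> ?q"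
      using q mult_right_mono[of ?q 1 ?q] by (simp add: power2_eq_square)
    then have "cmod \<zeta> ^ k * (cmod (\<mu> - of_real (b0 2)) * cmod \<zeta>) \<le> cmod \<zeta> ^ k * (?C * ?q)"
      by (intro mult_left_mono mult_mono) auto
    then show ?thesis unfolding 2 weyl_odd power_mult power_Suc q(1)
      by (simp add: norm_mult norm_power mult_ac)
  qed
qed

text \<open>The growth of p is at most reciprocal to the Weyl decay; the square root appears because
  \<zeta> is the multiplier over two sites.\<close>

lemma norm_dirichlet_le:
  assumes "cmod \<zeta> < 1"
  shows "\<exists>C\<ge>0. \<forall>n. cmod (dirichlet n) * sqrt (cmod \<zeta>) ^ n \<le> C"
proof -
  let ?r = "cmod \<zeta>" and ?q = "sqrt (cmod \<zeta>)"
  let ?K = "1 / (1 - ?r ^ 2)"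
  have r2: "?r ^ 2 < 1" "0 \<le> ?r ^ 2" using assms by (auto simp: power_less_one_iff abs_square_less_1)
  have q: "?q ^ 2 = ?r" "0 \<le> ?q" "?q \<le> 1" using assms by auto
  have ch1: "?r ^ k * cmod (cheb (Suc k)) \<le> ?K" for k
  proof -
    have "?r ^ k * cmod (cheb (Suc k)) \<le> (\<Sum>j\<le>k. (?r ^ 2) ^ j)" by (rule norm_cheb_le)
    also have "\<dots> \<le> (\<Sum>j. (?r ^ 2) ^ j)"
      using r2 by (intro sum_le_suminf summable_geometric) auto
    also have "\<dots> = ?K" using r2 by (intro suminf_geometric) auto
    finally show ?thesis .
  qed
  have ch: "?r ^ k * cmod (cheb k) \<le> ?K" for k
  proof (cases k)
    case 0
    then show ?thesis using r2 by simp
  next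
    case (Suc i)
    have "?r ^ k * cmod (cheb k) = ?r * (?r ^ i * cmod (cheb (Suc i)))" by (simp add: Suc del: cheb.simps)
    also have "\<dots> \<le> 1 * ?K"
      using ch1[of i] assms by (intro mult_mono) auto
    finally show ?thesis by simp
  qed
  let ?C = "cmod ((\<mu> - of_real (b0 1)) / of_real (a0 1)) * ?K + (?K + a0 2 / a0 1 * ?K)"
  have nn: "0 \<le> cmod ((\<mu> - of_real (b0 1)) / of_real (a0 1)) * ?K" "0 \<le> ?K + a0 2 / a0 1 * ?K"
    using r2 a0_pos'[of 1] a0_pos'[of 2] by auto
  show ?thesis
  proof (intro exI conjI allI)
    show "?C \<ge> 0" using nn by linarith
    fix n
    show "cmod (dirichlet n) * ?q ^ n \<le> ?C"
    proof (cases rule: parity_cases[of n])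
      case (1 k)
      have "cmod (dirichlet n) * ?q ^ n
          = cmod ((\<mu> - of_real (b0 1)) / of_real (a0 1)) * (?r ^ k * cmod (cheb k))"
        unfolding 1 dirichlet_even power_mult q(1) norm_mult by (simp only: mult_ac)
      also have "\<dots> \<le> cmod ((\<mu> - of_real (b0 1)) / of_real (a0 1)) * ?K"
        by (intro mult_left_mono ch) simp
      finally show ?thesis using nn(2) by linarith
    next
      case (2 k)
      have "cmod (dirichlet n) * ?q ^ n = ?q * (?r ^ k * cmod (dirichlet n))"
        unfolding 2 power_Suc power_mult q(1) by simp
      also have "\<dots> \<le> 1 * (?r ^ k * cmod (dirichlet n))"
        using q by (intro mult_right_mono) auto
      also have "\<dots> \<le> ?r ^ k * (cmod (cheb (Suc k)) + a0 2 / a0 1 * cmod (cheb k))"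
        unfolding 2 dirichlet_odd mult_1
        using norm_triangle_ineq[of "cheb (Suc k)" "of_real (a0 2 / a0 1) * cheb k"] a0_pos'[of 1] a0_pos'[of 2]
        by (intro mult_left_mono) (simp_all add: norm_mult norm_divide del: cheb.simps)
      also have "\<dots> = ?r ^ k * cmod (cheb (Suc k)) + a0 2 / a0 1 * (?r ^ k * cmod (cheb k))"
        by (simp add: distrib_left del: cheb.simps)
      also have "\<dots> \<le> ?K + a0 2 / a0 1 * ?K"
        using a0_pos'[of 1] a0_pos'[of 2] by (intro add_mono mult_left_mono ch ch1) auto
      finally show ?thesis using nn(1) by linarith
    qed
  qed
qed

text \<open>The preimage is the Green sum with kernel - p(min) \<phi>(max) / (a_2 \<phi>(0)). Growth
  of p and decay of \<phi> bound the kernel geometrically in |n - k|, so both halves of the sum are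
  dominated by the damped recursions \<open>A\<close> and \<open>B\<close>.\<close>

lemma onto:
  assumes zeta: "cmod \<zeta> < 1" and w0: "weyl 0 \<noteq> 0" and z: "z \<in> ell2"
  shows "\<exists>y\<in>ell2. \<forall>n. real_jacobi_op a0 b0 y n - \<mu> * y n = z n"
proof -
  let ?q = "sqrt (cmod \<zeta>)"
  have q: "0 < ?q" "?q < 1" using zeta zeta_nz by auto
  obtain C1 where C1: "C1 \<ge> 0" "\<And>n. cmod (weyl n) \<le> C1 * ?q ^ n"
    using norm_weyl_le[OF zeta] by auto
  obtain C2 where C2: "C2 \<ge> 0" "\<And>n. cmod (dirichlet n) * ?q ^ n \<le> C2"
    using norm_dirichlet_le[OF zeta] by auto
  have kernel: "cmod (dirichlet m) * cmod (weyl (m + j)) \<le> C1 * C2 * ?q ^ j" for m j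
  proof -
    have "cmod (dirichlet m) * cmod (weyl (m + j)) \<le> cmod (dirichlet m) * (C1 * ?q ^ (m + j))"
      by (intro mult_left_mono C1) simp
    also have "\<dots> = C1 * ?q ^ j * (cmod (dirichlet m) * ?q ^ m)"
      by (simp add: power_add)
    also have "\<dots> \<le> C1 * ?q ^ j * C2"
      using C1 q by (intro mult_left_mono C2) auto
    finally show ?thesis by (simp add: mult_ac)
  qed
  define W where "W = ell2_norm z"
  have zW: "cmod (z n) \<le> W" for n unfolding W_def by (rule norm_le_ell2_norm[OF z])
  have W: "W \<ge> 0" using zW[of 0] norm_ge_zero order_trans by blast
  have z0: "z 0 = 0" and sz: "summable (\<lambda>n. (cmod (z n))\<^sup>2)" using z by (auto simp: ell2_def)
  \<comment> \<open>The diagonal term belongs to \<open>P\<close>; \<open>F\<close> therefore starts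
    at \<open>Suc n\<close>.\<close>
  define P where "P n = (\<Sum>k\<le>n. dirichlet k * z k)" for n
  define F where "F n = (\<Sum>j. weyl (j + Suc n) * z (j + Suc n))" for n
  have geo: "summable (\<lambda>j. c * ?q ^ j * M)" for c M
    using q by (intro summable_mult summable_mult2 summable_geometric) auto
  have wz: "summable (\<lambda>j. weyl j * z j)"
  proof (rule summable_comparison_test'[OF geo[of C1 W]])
    show "norm (weyl n * z n) \<le> C1 * ?q ^ n * W" for n
      unfolding norm_mult using C1 q by (intro mult_mono C1 zW) auto
  qed
  have F_Suc: "F n = F (Suc n) + weyl (Suc n) * z (Suc n)" for n
    using suminf_split_head[OF summable_ignore_initial_segment[OF wz, of "Suc n"]]
    by (simp add: F_def)
  have P_Suc: "P (Suc n) = P n + dirichlet (Suc n) * z (Suc n)" for n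
    by (simp add: P_def)
  define y where "y n = - (weyl n * P n + dirichlet n * F n) / (of_real (a0 2) * weyl 0)" for n
  have y0: "y 0 = 0" by (simp add: y_def P_def z0)
  have res: "residual \<mu> y n = z (Suc n)" for n
  proof -
    let ?D = "of_real (a0 2) * weyl 0"
    have "?D \<noteq> 0" using w0 a0_nz[of 2] by simp
    have yD: "- ?D * y k = weyl k * P k + dirichlet k * F k" for k
      using \<open>?D \<noteq> 0\<close> by (simp add: y_def)
    \<comment> \<open>All three neighbours are expressed through \<open>P (Suc n)\<close> and
      \<open>F (Suc n)\<close>. The corrections at \<open>n + 2\<close> cancel, and those at
      \<open>n\<close> leave \<open>z (Suc n)\<close> times the constant Wronskian.\<close>
    have P0: "P n = P (Suc n) - dirichlet (Suc n) * z (Suc n)"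
      and F2: "F (Suc (Suc n)) = F (Suc n) - weyl (Suc (Suc n)) * z (Suc (Suc n))"
      using P_Suc[of n] F_Suc[of "Suc n"] by (simp_all add: algebra_simps)
    have "- ?D * residual \<mu> y n = residual \<mu> (\<lambda>k. - ?D * y k) n"
      by (rule residual_cmult[symmetric])
    also have "\<dots> = residual \<mu> weyl n * P (Suc n) + residual \<mu> dirichlet n * F (Suc n)
        + z (Suc n) * (of_real (a0 n) * (dirichlet n * weyl (Suc n) - dirichlet (Suc n) * weyl n))"
      unfolding yD residual_def P0 F_Suc[of n] P_Suc[of "Suc n"] F2 by (simp add: algebra_simps)
    also have "\<dots> = - ?D * z (Suc n)"
      unfolding residual_weyl residual_dirichlet wronskian_dirichlet_weyl by simp
    finally show ?thesis using \<open>?D \<noteq> 0\<close> by simp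
  qed
  define A where "A n = (\<Sum>k\<le>n. ?q ^ (n - k) * cmod (z k))" for n
  define B where "B n = (\<Sum>j. ?q ^ j * cmod (z (j + n)))" for n
  have sB: "summable (\<lambda>j. ?q ^ j * cmod (z (j + n)))" for n
  proof (rule summable_comparison_test'[OF geo[of 1 W]])
    show "norm (?q ^ j * cmod (z (j + n))) \<le> 1 * ?q ^ j * W" for j
      using q zW by (auto simp: norm_mult intro!: mult_left_mono)
  qed
  have "A (Suc n) = ?q * A n + cmod (z (Suc n))" for n
  proof -
    have "(\<Sum>k\<le>n. ?q ^ (Suc n - k) * cmod (z k)) = (\<Sum>k\<le>n. ?q * (?q ^ (n - k) * cmod (z k)))"
      by (intro sum.cong) (auto simp: Suc_diff_le)
    then show ?thesis by (simp add: A_def sum_distrib_left)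
  qed
  then have "summable (\<lambda>n. (A n)\<^sup>2)"
    by (rule summable_power2_forward_recursion[OF q sz])
  have "B n = ?q * B (Suc n) + cmod (z n)" for n
  proof -
    have "(\<Sum>j. ?q ^ Suc j * cmod (z (Suc j + n))) = (\<Sum>j. ?q * (?q ^ j * cmod (z (j + Suc n))))"
      by (simp add: mult.assoc)
    also have "\<dots> = ?q * B (Suc n)" unfolding B_def by (rule suminf_mult[OF sB])
    finally show ?thesis
      using suminf_split_head[OF sB[of n]] by (simp add: B_def)
  qed
  moreover have "\<bar>B n\<bar> \<le> (\<Sum>j. 1 * ?q ^ j * W)" for n
  proof -
    have "B n \<ge> 0" unfolding B_def using q by (intro suminf_nonneg sB) auto
    moreover have "B n \<le> (\<Sum>j. 1 * ?q ^ j * W)"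
      unfolding B_def using q zW by (intro suminf_le sB geo) (auto intro!: mult_left_mono)
    ultimately show ?thesis by simp
  qed
  ultimately have "summable (\<lambda>n. (B n)\<^sup>2)"
    by (rule summable_power2_backward_recursion[OF q sz])
  have wP: "cmod (weyl n * P n) \<le> C1 * C2 * A n" for n
  proof -
    have "cmod (weyl n * P n) \<le> (\<Sum>k\<le>n. cmod (weyl n * (dirichlet k * z k)))"
      unfolding P_def sum_distrib_left by (rule norm_sum)
    also have "\<dots> \<le> (\<Sum>k\<le>n. C1 * C2 * ?q ^ (n - k) * cmod (z k))"
    proof (rule sum_mono)
      fix k assume "k \<in> {..n}"
      then have "cmod (dirichlet k) * cmod (weyl n) * cmod (z k) \<le> C1 * C2 * ?q ^ (n - k) * cmod (z k)"
        using kernel[of k "n - k"] by (intro mult_right_mono) auto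
      then show "cmod (weyl n * (dirichlet k * z k)) \<le> C1 * C2 * ?q ^ (n - k) * cmod (z k)"
        by (simp add: norm_mult mult_ac)
    qed
    also have "\<dots> = C1 * C2 * A n"
      by (simp add: A_def sum_distrib_left mult.assoc)
    finally show ?thesis .
  qed
  have dF: "cmod (dirichlet n * F n) \<le> C1 * C2 * ?q * B (Suc n)" for n
  proof -
    have b: "norm (dirichlet n * (weyl (j + Suc n) * z (j + Suc n)))
        \<le> C1 * C2 * ?q * (?q ^ j * cmod (z (j + Suc n)))" for j
    proof -
      have "cmod (dirichlet n) * cmod (weyl (n + Suc j)) * cmod (z (j + Suc n))
          \<le> C1 * C2 * ?q ^ Suc j * cmod (z (j + Suc n))"
        by (intro mult_right_mono kernel) simp
      then show ?thesis by (simp add: norm_mult mult_ac add_ac)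
    qed
    have sb: "summable (\<lambda>j. C1 * C2 * ?q * (?q ^ j * cmod (z (j + Suc n))))"
      by (intro summable_mult sB)
    have "dirichlet n * F n = (\<Sum>j. dirichlet n * (weyl (j + Suc n) * z (j + Suc n)))"
      unfolding F_def by (rule suminf_mult[symmetric, OF summable_ignore_initial_segment[OF wz]])
    also have "cmod \<dots> \<le> (\<Sum>j. C1 * C2 * ?q * (?q ^ j * cmod (z (j + Suc n))))"
      by (rule norm_suminf_le[OF b sb])
    also have "\<dots> = C1 * C2 * ?q * B (Suc n)"
      unfolding B_def by (rule suminf_mult[OF sB])
    finally show ?thesis .
  qed
  have "summable (\<lambda>n. (cmod (weyl n * P n))\<^sup>2)"
  proof (rule summable_comparison_test')
    show "summable (\<lambda>n. (C1 * C2)\<^sup>2 * (A n)\<^sup>2)" by (rule summable_mult) fact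
    show "norm ((cmod (weyl n * P n))\<^sup>2) \<le> (C1 * C2)\<^sup>2 * (A n)\<^sup>2" for n
      using power_mono[OF wP[of n], of 2] by (simp add: power_mult_distrib)
  qed
  moreover have "summable (\<lambda>n. (cmod (dirichlet n * F n))\<^sup>2)"
  proof (rule summable_comparison_test')
    have "summable (\<lambda>n. (B (Suc n))\<^sup>2)"
      by (subst summable_Suc_iff[where f="\<lambda>n. (B n)\<^sup>2"]) fact
    then show "summable (\<lambda>n. (C1 * C2 * ?q)\<^sup>2 * (B (Suc n))\<^sup>2)" by (rule summable_mult)
    show "norm ((cmod (dirichlet n * F n))\<^sup>2) \<le> (C1 * C2 * ?q)\<^sup>2 * (B (Suc n))\<^sup>2" for n
      using power_mono[OF dF[of n], of 2] by (simp add: power_mult_distrib)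
  qed
  ultimately have "summable (\<lambda>n. (cmod (- 1 / (of_real (a0 2) * weyl 0) * (weyl n * P n + dirichlet n * F n)))\<^sup>2)"
    by (intro summable_norm_power2_bounded_mult[OF order_refl] summable_norm_power2_add)
  moreover have "- 1 / (of_real (a0 2) * weyl 0) * (weyl n * P n + dirichlet n * F n) = y n" for n
    unfolding y_def by (simp only: minus_divide_left[symmetric] times_divide_eq_left mult_minus_left mult_1)
  ultimately have "y \<in> ell2" using y0 by (simp only: ell2_def mem_Collect_eq simp_thms)
  moreover have "real_jacobi_op a0 b0 y n - \<mu> * y n = z n" for n
    using z0 y0 by (cases n) (simp_all add: real_jacobi_op_0 real_jacobi_op_Suc[of _ _ \<mu>] res)
  ultimately show ?thesis by blast
qed

lemma small_multiplier_imp_not_continuous_spectrum: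
  assumes "cmod \<zeta> < 1" "weyl 0 \<noteq> 0"
  shows "\<mu> \<notin> continuous_spectrum (real_jacobi_op a0 b0)"
proof -
  have "(\<lambda>y n. real_jacobi_op a0 b0 y n - \<mu> * y n) ` ell2 = ell2"
  proof
    show "(\<lambda>y n. real_jacobi_op a0 b0 y n - \<mu> * y n) ` ell2 \<subseteq> ell2"
      using real_jacobi_op_ell2 by auto
    show "ell2 \<subseteq> (\<lambda>y n. real_jacobi_op a0 b0 y n - \<mu> * y n) ` ell2"
    proof
      fix z :: "nat \<Rightarrow> complex" assume "z \<in> ell2"
      then obtain y where "y \<in> ell2" "\<And>n. real_jacobi_op a0 b0 y n - \<mu> * y n = z n"
        using onto[OF assms] by blast
      then show "z \<in> (\<lambda>y n. real_jacobi_op a0 b0 y n - \<mu> * y n) ` ell2"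
        by (intro image_eqI[of _ _ y]) auto
    qed
  qed
  then show ?thesis unfolding continuous_spectrum_def by simp
qed

end

section \<open>Existence and uniqueness of the multiplier\<close>

lemma ex_multiplier: "\<exists>\<zeta>::complex. \<zeta> \<noteq> 0 \<and> cmod \<zeta> \<le> 1 \<and> \<zeta> + 1 / \<zeta> = D"
proof -
  \<comment> \<open>\<open>?u\<close> and \<open>?v\<close> are the roots of X^2 - D X + 1. Their
    product is 1, so one of them lies in the closed unit disc.\<close>
  define r where "r = csqrt (D\<^sup>2 - 4)"
  let ?u = "(D + r) / 2" and ?v = "(D - r) / 2"
  have "r\<^sup>2 = D\<^sup>2 - 4" by (simp add: r_def)
  then have uv: "?u * ?v = 1" by (simp add: power2_eq_square algebra_simps)
  then have nz: "?u \<noteq> 0" "?v \<noteq> 0" by auto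
  have inv: "1 / ?u = ?v" "1 / ?v = ?u"
    using uv nz by (simp_all add: divide_eq_eq mult.commute)
  have "cmod ?u * cmod ?v = 1" using uv by (metis norm_mult norm_one)
  then have "cmod ?u \<le> 1 \<or> cmod ?v \<le> 1"
    using mult_strict_mono[of 1 "cmod ?u" 1 "cmod ?v"] by force
  moreover have "?u + 1 / ?u = D" "?v + 1 / ?v = D"
    unfolding inv by (simp_all add: field_simps)
  ultimately show ?thesis using nz by blast
qed

lemma multiplier_unique:
  fixes \<zeta> \<omega> :: complex
  assumes "\<zeta> \<noteq> 0" "\<omega> \<noteq> 0" "cmod \<zeta> < 1" "cmod \<omega> < 1" "\<zeta> + inverse \<zeta> = \<omega> + inverse \<omega>"
  shows "\<zeta> = \<omega>"
proof -
  have "(\<zeta> - \<omega>) * (\<zeta> * \<omega> - 1) = ((\<zeta> + inverse \<zeta>) - (\<omega> + inverse \<omega>)) * (\<zeta> * \<omega>)"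
    using assms(1,2) by (simp add: algebra_simps)
  also have "\<dots> = 0" unfolding assms(5) by simp
  finally have "(\<zeta> - \<omega>) * (\<zeta> * \<omega> - 1) = 0" .
  moreover have "cmod (\<zeta> * \<omega>) \<le> cmod \<zeta> * 1"
    unfolding norm_mult using assms(4) by (intro mult_left_mono) auto
  then have "\<zeta> * \<omega> \<noteq> 1" using assms(3) by auto
  ultimately show ?thesis by simp
qed

lemma unit_add_inverse:
  assumes "cmod \<zeta> = 1"
  shows "\<zeta> + 1 / \<zeta> = of_real (2 * Re \<zeta>)"
proof -
  have "\<zeta> * cnj \<zeta> = 1" using assms by (simp add: complex_norm_square[symmetric])
  then have "1 / \<zeta> = cnj \<zeta>" by (auto simp: divide_eq_eq mult.commute)
  then show ?thesis by (simp add: complex_add_cnj)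
qed

section \<open>Band edges and the multiplier at \<nu>\<close>

context periodic_jacobi
begin

lemma floquetI:
  assumes "\<zeta> \<noteq> 0"
    and "(\<mu> - of_real (b0 1)) * (\<mu> - of_real (b0 2))
      = of_real (a0 1) * of_real (a0 2) * (\<zeta> + 1 / \<zeta>) + (of_real (a0 1))\<^sup>2 + (of_real (a0 2))\<^sup>2"
  shows "floquet a0 b0 \<mu> \<zeta>"
proof unfold_locales
  show "(\<mu> - of_real (b0 1)) * (\<mu> - of_real (b0 2)) * \<zeta>
      = (of_real (a0 1) + of_real (a0 2) * \<zeta>) * (of_real (a0 2) + of_real (a0 1) * \<zeta>)"
    unfolding assms(2) using assms(1) by (simp add: field_simps power2_eq_square)
qed fact

lemma ex_floquet: "\<exists>\<zeta>. cmod \<zeta> \<le> 1 \<and> floquet a0 b0 \<mu> \<zeta>"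
proof -
  let ?a = "of_real (a0 1) :: complex" and ?b = "of_real (a0 2) :: complex"
  have nz: "?a * ?b \<noteq> 0" using a0_pos'[of 1] a0_pos'[of 2] by simp
  obtain \<zeta> where "\<zeta> \<noteq> 0" "cmod \<zeta> \<le> 1"
    "\<zeta> + 1 / \<zeta> = ((\<mu> - of_real (b0 1)) * (\<mu> - of_real (b0 2)) - ?a\<^sup>2 - ?b\<^sup>2) / (?a * ?b)"
    using ex_multiplier by blast
  moreover from this have "floquet a0 b0 \<mu> \<zeta>"
    using nz by (intro floquetI) simp_all
  ultimately show ?thesis by blast
qed

text \<open>
  If \<open>a\<^sub>1 < a\<^sub>2\<close>, then the Dirichlet solution at \<open>\<mu> = b\<^sub>1\<close> vanishes at even indices and
  decays like \<open>(a\<^sub>1 / a\<^sub>2)\<^sup>k\<close> at odd ones, so \<open>b\<^sub>1\<close> is an eigenvalue.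
\<close>

lemma a0_decreasing:
  assumes no_ev: "eigenvalues (real_jacobi_op a0 b0) = {}" and neq: "a0 1 \<noteq> a0 2"
  shows "a0 2 < a0 1"
proof (rule ccontr)
  assume "\<not> a0 2 < a0 1"
  with neq have lt: "a0 1 < a0 2" by simp
  have pos: "a0 1 > 0" "a0 2 > 0" using a0_pos' by auto
  define r where "r = a0 1 / a0 2"
  have r: "0 < r" "r < 1" using lt pos by (auto simp: r_def)
  define \<zeta> where "\<zeta> = - complex_of_real r"
  have zeta_eq: "\<zeta> = - of_real (a0 1) / of_real (a0 2)" by (simp add: \<zeta>_def r_def)
  interpret floquet a0 b0 "of_real (b0 1)" \<zeta>
    using pos by unfold_locales (auto simp: zeta_eq)
  have div_zeta: "x / \<zeta> = - of_real (a0 2 / a0 1) * x" for x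
    using pos by (simp add: zeta_eq field_simps)
  have odd: "dirichlet (Suc (2 * k)) = \<zeta> ^ k" for k
    unfolding dirichlet_odd cheb.simps div_zeta by simp
  have norm_zeta: "cmod \<zeta> = r" using r by (simp add: \<zeta>_def)
  have "summable (\<lambda>n. (cmod (dirichlet n))\<^sup>2)"
  proof (rule summable_comparison_test')
    show "summable (\<lambda>n. r ^ n / r)"
      using r by (intro summable_divide summable_geometric) auto
    show "norm ((cmod (dirichlet n))\<^sup>2) \<le> r ^ n / r" for n
    proof (cases rule: parity_cases[of n])
      case (1 k)
      then show ?thesis unfolding 1 dirichlet_even using r by simp
    next
      case (2 k)
      then show ?thesis unfolding 2 odd using r
        by (simp add: norm_power norm_zeta power_mult[symmetric] mult.commute)
    qed
  qed
  then show False using dirichlet_not_summable[OF no_ev] by contradiction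
qed

text \<open>Once \<open>a0 2 < a0 1\<close>, this keeps the Green function denominator away from 0
  uniformly in \<mu>.\<close>

lemma weyl_0_ge:
  assumes "floquet a0 b0 \<mu> \<zeta>" "cmod \<zeta> \<le> 1"
  shows "a0 1 - a0 2 \<le> cmod (floquet.weyl a0 b0 \<mu> \<zeta> 0)"
proof -
  interpret floquet a0 b0 \<mu> \<zeta> by fact
  have "a0 2 * cmod \<zeta> \<le> a0 2" using assms(2) a0_pos'[of 2] by simp
  moreover have "cmod (of_real (a0 1)) = a0 1" "cmod (of_real (a0 2) * \<zeta>) = a0 2 * cmod \<zeta>"
    using a0_pos'[of 1] a0_pos'[of 2] by (simp_all add: norm_mult)
  ultimately show ?thesis
    unfolding weyl_0 using norm_diff_ineq[of "of_real (a0 1)" "of_real (a0 2) * \<zeta>"] by linarith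
qed

text \<open>Spectral points are those with a unimodular multiplier. There \<zeta> + 1/\<zeta> is
  twice the real part of \<zeta> and sweeps [-2, 2], which the characteristic equation turns into
  the stated interval.\<close>

lemma continuous_spectrum_real_iff:
  assumes no_ev: "eigenvalues (real_jacobi_op a0 b0) = {}" and neq: "a0 1 \<noteq> a0 2"
  shows "of_real x \<in> continuous_spectrum (real_jacobi_op a0 b0) \<longleftrightarrow>
    (x - b0 1) * (x - b0 2) \<in> {(a0 1 - a0 2)\<^sup>2..(a0 1 + a0 2)\<^sup>2}"
proof
  have pos: "a0 1 > 0" "a0 2 > 0" using a0_pos' by auto
  assume cs: "of_real x \<in> continuous_spectrum (real_jacobi_op a0 b0)"
  obtain \<zeta> where z: "cmod \<zeta> \<le> 1" "floquet a0 b0 (of_real x) \<zeta>"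
    using ex_floquet by blast
  interpret floquet a0 b0 "of_real x" \<zeta> by fact
  have "weyl 0 \<noteq> 0"
    using weyl_0_ge[OF z(2,1)] a0_decreasing[OF no_ev neq] by auto
  then have "cmod \<zeta> = 1"
    using small_multiplier_imp_not_continuous_spectrum cs z(1) by fastforce
  have "complex_of_real ((x - b0 1) * (x - b0 2)) = of_real (a0 1 * a0 2 * (2 * Re \<zeta>) + (a0 1)\<^sup>2 + (a0 2)\<^sup>2)"
    using char_eq' unfolding unit_add_inverse[OF \<open>cmod \<zeta> = 1\<close>] by simp
  then have eq: "(x - b0 1) * (x - b0 2) = 2 * (a0 1 * a0 2) * Re \<zeta> + (a0 1)\<^sup>2 + (a0 2)\<^sup>2"
    by (simp only: of_real_eq_iff)
  have "\<bar>Re \<zeta>\<bar> \<le> 1" using abs_Re_le_cmod[of \<zeta>] \<open>cmod \<zeta> = 1\<close> by simp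
  then have "2 * (a0 1 * a0 2) * Re \<zeta> \<le> 2 * (a0 1 * a0 2) * 1"
    "2 * (a0 1 * a0 2) * (-1) \<le> 2 * (a0 1 * a0 2) * Re \<zeta>"
    using pos by (intro mult_left_mono; simp)+
  then show "(x - b0 1) * (x - b0 2) \<in> {(a0 1 - a0 2)\<^sup>2..(a0 1 + a0 2)\<^sup>2}"
    unfolding eq by (simp add: power2_sum power2_diff)
next
  have pos: "a0 1 > 0" "a0 2 > 0" using a0_pos' by auto
  assume *: "(x - b0 1) * (x - b0 2) \<in> {(a0 1 - a0 2)\<^sup>2..(a0 1 + a0 2)\<^sup>2}"
  define e where "e = ((x - b0 1) * (x - b0 2) - (a0 1)\<^sup>2 - (a0 2)\<^sup>2) / (2 * (a0 1 * a0 2))"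
  have e: "\<bar>e\<bar> \<le> 1"
    unfolding abs_le_iff e_def using * pos
    by (auto simp: pos_divide_le_eq minus_divide_left power2_sum power2_diff mult.assoc)
  then have e2: "e\<^sup>2 \<le> 1" by (simp add: abs_square_le_1)
  define \<zeta> where "\<zeta> = Complex e (sqrt (1 - e\<^sup>2))"
  have norm_zeta: "cmod \<zeta> = 1" using e2 by (simp add: \<zeta>_def cmod_def)
  have "floquet a0 b0 (of_real x) \<zeta>"
  proof (rule floquetI)
    show "\<zeta> \<noteq> 0" using norm_zeta by auto
    have "(x - b0 1) * (x - b0 2) = a0 1 * a0 2 * (2 * e) + (a0 1)\<^sup>2 + (a0 2)\<^sup>2"
      using pos by (simp add: e_def field_simps)
    then have "complex_of_real ((x - b0 1) * (x - b0 2)) = of_real (a0 1 * a0 2 * (2 * e) + (a0 1)\<^sup>2 + (a0 2)\<^sup>2)"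
      by (rule arg_cong)
    then show "(of_real x - of_real (b0 1)) * (of_real x - of_real (b0 2))
      = of_real (a0 1) * of_real (a0 2) * (\<zeta> + 1 / \<zeta>) + (of_real (a0 1))\<^sup>2 + (complex_of_real (a0 2))\<^sup>2"
      unfolding unit_add_inverse[OF norm_zeta] by (simp add: \<zeta>_def)
  qed
  then show "of_real x \<in> continuous_spectrum (real_jacobi_op a0 b0)"
    using floquet.unit_multiplier_imp_continuous_spectrum[OF _ no_ev norm_zeta] by blast
qed

lemma band_edges:
  assumes no_ev: "eigenvalues (real_jacobi_op a0 b0) = {}" and neq: "a0 1 \<noteq> a0 2"
    and sd: "0 < s" "s < d"
    and cs: "continuous_spectrum (real_jacobi_op a0 b0) = of_real ` ({-d..-s} \<union> {s..d})"
  shows "b0 2 = - b0 1" "d\<^sup>2 = (b0 1)\<^sup>2 + (a0 1 + a0 2)\<^sup>2" "s\<^sup>2 = (b0 1)\<^sup>2 + (a0 1 - a0 2)\<^sup>2"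
proof -
  have pos: "a0 1 > 0" "a0 2 > 0" using a0_pos' by auto
  have iff: "(x - b0 1) * (x - b0 2) \<in> {(a0 1 - a0 2)\<^sup>2..(a0 1 + a0 2)\<^sup>2} \<longleftrightarrow> x \<in> {-d..-s} \<union> {s..d}" for x
    unfolding continuous_spectrum_real_iff[OF no_ev neq, symmetric] cs by (auto simp: image_iff)
  \<comment> \<open>The spectrum is symmetric about \<open>(b\<^sub>1 + b\<^sub>2) / 2\<close> as well as about \<open>0\<close>.\<close>
  have reflect: "b0 1 + b0 2 - x \<in> {-d..-s} \<union> {s..d}" if "x \<in> {-d..-s} \<union> {s..d}" for x
  proof -
    have "(b0 1 + b0 2 - x - b0 1) * (b0 1 + b0 2 - x - b0 2) = (x - b0 1) * (x - b0 2)"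
      by (simp add: algebra_simps)
    then show ?thesis using that unfolding iff[symmetric] by simp
  qed
  \<comment> \<open>Reflecting d and -d must not leave [-d, d], which bounds
    \<open>b0 1 + b0 2\<close> by 0 from both sides.\<close>
  show b2: "b0 2 = - b0 1"
    using reflect[of d] reflect[of "-d"] sd by auto
  have sq: "(x - b0 1) * (x - b0 2) = x\<^sup>2 - (b0 1)\<^sup>2" for x
    by (simp add: b2 algebra_simps power2_eq_square)
  have le: "(a0 1 - a0 2)\<^sup>2 \<le> (a0 1 + a0 2)\<^sup>2"
    using pos by (simp add: power2_sum power2_diff)
  let ?d = "sqrt ((b0 1)\<^sup>2 + (a0 1 + a0 2)\<^sup>2)" and ?s = "sqrt ((b0 1)\<^sup>2 + (a0 1 - a0 2)\<^sup>2)"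
  have "?d \<ge> 0" "?s \<ge> 0" by auto
  \<comment> \<open>Each edge formula comes from two inequalities: the computed edge lies in the
    given set, and the given edge satisfies the computed condition.\<close>
  have "?d \<in> {-d..-s} \<union> {s..d}"
    unfolding iff[symmetric] sq using le by simp
  then have "?d \<le> d" using \<open>?d \<ge> 0\<close> sd by auto
  then have "?d\<^sup>2 \<le> d\<^sup>2" using \<open>?d \<ge> 0\<close> by (rule power_mono)
  moreover have "d\<^sup>2 \<le> (b0 1)\<^sup>2 + (a0 1 + a0 2)\<^sup>2"
    using iff[of d] sd unfolding sq by auto
  ultimately show "d\<^sup>2 = (b0 1)\<^sup>2 + (a0 1 + a0 2)\<^sup>2" by simp
  have "?s \<in> {-d..-s} \<union> {s..d}"
    unfolding iff[symmetric] sq using le by simp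
  then have "s \<le> ?s" using \<open>?s \<ge> 0\<close> sd unfolding Un_iff atLeastAtMost_iff by linarith
  then have "s\<^sup>2 \<le> ?s\<^sup>2" using sd by (intro power_mono) auto
  moreover have "(b0 1)\<^sup>2 + (a0 1 - a0 2)\<^sup>2 \<le> s\<^sup>2"
    using iff[of s] sd unfolding sq by auto
  ultimately show "s\<^sup>2 = (b0 1)\<^sup>2 + (a0 1 - a0 2)\<^sup>2" by simp
qed

text \<open>At \<open>b0 1\<close> the left-hand side of the characteristic equation vanishes, so
  the multipliers are the zeros \<open>- a0 2 / a0 1\<close> and \<open>- a0 1 / a0 2\<close> of the
  right-hand side; only the first lies inside the disc.\<close>

lemma w_sq_at_b0:
  assumes lt: "a0 2 < a0 1"
    and d: "d\<^sup>2 = (b0 1)\<^sup>2 + (a0 1 + a0 2)\<^sup>2" and s: "s\<^sup>2 = (b0 1)\<^sup>2 + (a0 1 - a0 2)\<^sup>2"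
  shows "w_sq s d (of_real (b0 1)) = - of_real (a0 2 / a0 1)"
proof -
  have pos: "a0 1 > 0" "a0 2 > 0" using a0_pos' by auto
  let ?z = "- complex_of_real (a0 2 / a0 1)"
  have diff: "d\<^sup>2 - s\<^sup>2 = 4 * (a0 1 * a0 2)" and sum: "d\<^sup>2 + s\<^sup>2 = 2 * ((b0 1)\<^sup>2 + (a0 1)\<^sup>2 + (a0 2)\<^sup>2)"
    unfolding d s by (simp_all add: power2_sum power2_diff)
  have "2 * (2 / (d\<^sup>2 - s\<^sup>2) * ((b0 1)\<^sup>2 - (d\<^sup>2 + s\<^sup>2) / 2)) = - (a0 2 / a0 1) - a0 1 / a0 2"
    unfolding diff sum using pos by (simp add: field_simps power2_eq_square)
  then have "complex_of_real (2 * (2 / (d\<^sup>2 - s\<^sup>2) * ((b0 1)\<^sup>2 - (d\<^sup>2 + s\<^sup>2) / 2))) = of_real (- (a0 2 / a0 1) - a0 1 / a0 2)"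
    by (rule arg_cong)
  then have u: "2 * floquet_u s d (of_real (b0 1)) = ?z + inverse ?z"
    by (simp add: floquet_u_def)
  have z: "?z \<noteq> 0" "cmod ?z < 1"
    using lt pos by (simp_all add: norm_divide)
  show ?thesis
    unfolding w_sq_def
  proof (rule the_equality)
    show "?z \<noteq> 0 \<and> cmod ?z < 1 \<and> ?z + inverse ?z = 2 * floquet_u s d (of_real (b0 1))"
      using z u by simp
    show "\<zeta> = ?z" if "\<zeta> \<noteq> 0 \<and> cmod \<zeta> < 1 \<and> \<zeta> + inverse \<zeta> = 2 * floquet_u s d (of_real (b0 1))" for \<zeta>
      using that z unfolding u by (elim conjE) (rule multiplier_unique)
  qed
qed

end

section \<open>Perturbations\<close>

context floquet
begin

text \<open>Powers of \<zeta> from the Weyl solution cancel the growth of p up to a linear factor,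
  and the remaining ones absorb the weight because \<rho>^2 |\<zeta>| \<le> 1. The constant depends
  neither on \<mu> nor on the distance of \<zeta> to the unit circle.\<close>

lemma weighted_kernel_le:
  assumes b2: "b0 2 = - b0 1" and lt: "a0 2 < a0 1"
    and d: "d \<ge> 0" "d\<^sup>2 = (b0 1)\<^sup>2 + (a0 1 + a0 2)\<^sup>2"
    and zeta: "cmod \<zeta> \<le> 1" and rho: "\<rho> \<ge> 1" "\<rho>\<^sup>2 * cmod \<zeta> \<le> 1" and "m \<le> M"
  shows "cmod (dirichlet m) * cmod (weyl M) * \<rho> ^ (M - m) \<le> 2 * d / (a0 1 - a0 2) * real m * cmod (weyl 0)"
proof -
  let ?r = "cmod \<zeta>" and ?a = "a0 1" and ?b = "a0 2" and ?\<nu> = "complex_of_real (b0 1)"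
  have pos: "?a > 0" "?b > 0" using a0_pos' by auto
  have r: "?r \<ge> 0" "?r \<le> 1" using zeta by auto
  have rr: "0 \<le> ?r * \<rho>\<^sup>2" "?r * \<rho>\<^sup>2 \<le> 1" using rho(2) by (simp_all add: mult.commute)
  have pw: "(?r * \<rho>\<^sup>2) ^ k \<le> 1" for k using rr by (intro power_le_one)
  \<comment> \<open>Needed when \<open>m\<close> and \<open>M\<close> have different parity:
    \<open>M - m\<close> is then odd, and one unpaired \<rho> remains.\<close>
  have "\<rho> * ?r \<le> \<rho>\<^sup>2 * ?r"
    using rho r by (intro mult_right_mono self_le_power) auto
  then have rho_r: "\<rho> * ?r \<le> 1" using rho by linarith
  have ab_d: "?a + ?b \<le> d" by (rule power2_le_imp_le) (use d in auto)
  have b_d: "\<bar>b0 1\<bar> \<le> d" using abs_le_square_iff[of "b0 1" d] d by simp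
  have dK: "2 * d / (?a - ?b) \<ge> 2"
    using lt ab_d pos by (simp add: pos_le_divide_eq)
  have w0: "?a - ?b \<le> cmod (weyl 0)"
    using weyl_0_ge[OF floquet_axioms zeta] .
  have n1: "cmod (of_real ?a + of_real ?b * \<zeta>) \<le> ?a + ?b" "cmod (of_real ?b + of_real ?a * \<zeta>) \<le> ?a + ?b"
  proof -
    have "cmod (of_real ?a) = ?a" "cmod (of_real ?b) = ?b"
      "cmod (of_real ?b * \<zeta>) \<le> ?b" "cmod (of_real ?a * \<zeta>) \<le> ?a"
      using pos r by (simp_all add: norm_mult)
    then show "cmod (of_real ?a + of_real ?b * \<zeta>) \<le> ?a + ?b" "cmod (of_real ?b + of_real ?a * \<zeta>) \<le> ?a + ?b"
      using norm_triangle_ineq[of "of_real ?a" "of_real ?b * \<zeta>"] norm_triangle_ineq[of "of_real ?b" "of_real ?a * \<zeta>"]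
      by linarith+
  qed
  have mu_b2: "\<mu> - of_real (b0 2) = \<mu> + ?\<nu>" by (simp add: b2)
  have ce: "cmod (\<mu> - ?\<nu>) * cmod (\<mu> + ?\<nu>) * ?r = cmod (weyl 0) * cmod (of_real ?b + of_real ?a * \<zeta>)"
    using arg_cong[OF char_eq, of cmod] unfolding mu_b2 weyl_0 norm_mult .
  \<comment> \<open>\<mu> is unbounded, but the characteristic equation bounds the modulus of
    \<mu>^2 - \<nu>^2 times that of \<zeta>, so one factor \<zeta> tames one factor \<mu>.\<close>
  have mu_r: "cmod \<mu> * ?r \<le> d"
  proof (rule power2_le_imp_le)
    have "cmod (\<mu>\<^sup>2 - ?\<nu>\<^sup>2) * ?r = cmod (\<mu> - ?\<nu>) * cmod (\<mu> + ?\<nu>) * ?r"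
      by (simp add: norm_mult[symmetric] power2_eq_square algebra_simps)
    also have "\<dots> \<le> (?a + ?b) * (?a + ?b)"
      unfolding ce weyl_0 using n1 pos by (intro mult_mono) auto
    finally have *: "cmod (\<mu>\<^sup>2 - ?\<nu>\<^sup>2) * ?r \<le> (?a + ?b)\<^sup>2" by (simp add: power2_eq_square)
    have "cmod (\<mu>\<^sup>2) \<le> cmod (\<mu>\<^sup>2 - ?\<nu>\<^sup>2) + cmod (?\<nu>\<^sup>2)"
      using norm_triangle_ineq[of "\<mu>\<^sup>2 - ?\<nu>\<^sup>2" "?\<nu>\<^sup>2"] by simp
    then have "(cmod \<mu>)\<^sup>2 \<le> cmod (\<mu>\<^sup>2 - ?\<nu>\<^sup>2) + (b0 1)\<^sup>2"
      by (simp add: norm_power)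
    then have "(cmod \<mu>)\<^sup>2 * ?r \<le> (cmod (\<mu>\<^sup>2 - ?\<nu>\<^sup>2) + (b0 1)\<^sup>2) * ?r"
      using r by (intro mult_right_mono)
    also have "\<dots> \<le> (?a + ?b)\<^sup>2 + (b0 1)\<^sup>2"
      unfolding distrib_right using * r mult_left_mono[of ?r 1 "(b0 1)\<^sup>2"] by (intro add_mono) auto
    finally have **: "(cmod \<mu>)\<^sup>2 * ?r \<le> d\<^sup>2" using d by simp
    have "(cmod \<mu> * ?r)\<^sup>2 = (cmod \<mu>)\<^sup>2 * ?r * ?r" by (simp add: power2_eq_square mult_ac)
    also have "\<dots> \<le> (cmod \<mu>)\<^sup>2 * ?r * 1" using r by (intro mult_left_mono) auto
    finally show "(cmod \<mu> * ?r)\<^sup>2 \<le> d\<^sup>2" using ** by simp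
  qed (rule d)
  have nu_r: "cmod ?\<nu> * ?r \<le> d"
    using b_d r d mult_mono[of "\<bar>b0 1\<bar>" d ?r 1] by simp
  have pm: "cmod (\<mu> - ?\<nu>) * ?r \<le> 2 * d" "cmod (\<mu> + ?\<nu>) * ?r \<le> 2 * d"
    using mult_right_mono[OF norm_triangle_ineq4[of \<mu> ?\<nu>] r(1)]
      mult_right_mono[OF norm_triangle_ineq[of \<mu> ?\<nu>] r(1)] mu_r nu_r
    by (simp_all add: distrib_right)
  have ch: "?r ^ k * cmod (cheb k) \<le> ?r * real k" for k
    using norm_cheb_le_linear[OF zeta] .
  have ch1: "?r ^ k * cmod (cheb (Suc k)) \<le> real (Suc k)" for k
  proof -
    have "?r ^ k * cmod (cheb (Suc k)) \<le> (\<Sum>j\<le>k. (?r ^ 2) ^ j)" by (rule norm_cheb_le)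
    also have "\<dots> \<le> (\<Sum>j\<le>k. 1)" using r by (intro sum_mono power_le_one) auto
    finally show ?thesis by simp
  qed
  have odd_le: "?r ^ k * cmod (dirichlet (Suc (2 * k))) \<le> real (Suc (2 * k))" for k
  proof -
    have "?r ^ k * cmod (dirichlet (Suc (2 * k))) \<le> ?r ^ k * (cmod (cheb (Suc k)) + ?b / ?a * cmod (cheb k))"
      unfolding dirichlet_odd
      using norm_triangle_ineq[of "cheb (Suc k)" "of_real (?b / ?a) * cheb k"] pos r
      by (intro mult_left_mono) (simp_all add: norm_mult norm_divide del: cheb.simps)
    also have "\<dots> = ?r ^ k * cmod (cheb (Suc k)) + ?b / ?a * (?r ^ k * cmod (cheb k))"
      by (simp add: distrib_left del: cheb.simps)
    also have "\<dots> \<le> real (Suc k) + 1 * (?r * real k)"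
      using pos lt r by (intro add_mono mult_mono ch ch1) auto
    also have "\<dots> \<le> real (Suc (2 * k))" using r mult_right_mono[of ?r 1 "real k"] by simp
    finally show ?thesis .
  qed
  have even_eq: "?r ^ k * cmod (dirichlet (2 * k)) = cmod (\<mu> - ?\<nu>) / ?a * (?r ^ k * cmod (cheb k))" for k
    unfolding dirichlet_even using pos by (simp add: norm_mult norm_divide)
  show ?thesis
  proof (cases rule: parity_cases[of m]; cases rule: parity_cases[of M])
    fix i j assume mM: "m = 2 * i" "M = 2 * j"
    then obtain e where j: "j = i + e" using \<open>m \<le> M\<close> le_Suc_ex by auto
    have "cmod (dirichlet m) * cmod (weyl M) * \<rho> ^ (M - m)
        = ?r ^ i * cmod (dirichlet (2 * i)) * cmod (weyl 0) * (?r * \<rho>\<^sup>2) ^ e"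
      unfolding mM j weyl_even weyl_0
      by (simp add: norm_mult norm_power power_add power_mult_distrib power_mult[symmetric] mult_ac)
    also have "\<dots> \<le> ?r ^ i * cmod (dirichlet (2 * i)) * cmod (weyl 0) * 1"
      using r pw by (intro mult_left_mono) auto
    also have "\<dots> = cmod (\<mu> - ?\<nu>) / ?a * (?r ^ i * cmod (cheb i)) * cmod (weyl 0)"
      unfolding even_eq by simp
    also have "\<dots> \<le> cmod (\<mu> - ?\<nu>) / ?a * (?r * real i) * cmod (weyl 0)"
      using pos by (intro mult_right_mono mult_left_mono ch) auto
    also have "\<dots> = cmod (\<mu> - ?\<nu>) * ?r / ?a * real i * cmod (weyl 0)" by simp
    also have "\<dots> \<le> 2 * d / (?a - ?b) * real m * cmod (weyl 0)"
    proof -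
      have "cmod (\<mu> - ?\<nu>) * ?r / ?a \<le> 2 * d / (?a - ?b)"
        by (rule frac_le) (use pos lt pm d in auto)
      then show ?thesis
        unfolding mM using r pos dK by (intro mult_right_mono mult_mono) auto
    qed
    finally show ?thesis .
  next
    fix i j assume mM: "m = 2 * i" "M = Suc (2 * j)"
    then have "i \<le> j" using \<open>m \<le> M\<close> by presburger
    then obtain e where j: "j = i + e" using le_Suc_ex by auto
    have "cmod (dirichlet m) * cmod (weyl M) * \<rho> ^ (M - m)
        = ?r ^ i * cmod (dirichlet (2 * i)) * (cmod (\<mu> + ?\<nu>) * (\<rho> * ?r)) * (?r * \<rho>\<^sup>2) ^ e"
    proof -
      have "M - m = Suc (2 * e)" by (simp add: mM j)
      then show ?thesis
        unfolding mM j weyl_odd mu_b2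
        by (simp add: norm_mult norm_power power_add power_mult_distrib power_mult[symmetric] mult_ac)
    qed
    also have "\<dots> \<le> ?r ^ i * cmod (dirichlet (2 * i)) * (cmod (\<mu> + ?\<nu>) * 1) * 1"
      using r pw rho rho_r by (intro mult_mono mult_left_mono) auto
    also have "\<dots> = cmod (\<mu> - ?\<nu>) / ?a * (?r ^ i * cmod (cheb i)) * cmod (\<mu> + ?\<nu>)"
      unfolding even_eq by simp
    also have "\<dots> \<le> cmod (\<mu> - ?\<nu>) / ?a * (?r * real i) * cmod (\<mu> + ?\<nu>)"
      using pos by (intro mult_right_mono mult_left_mono ch) auto
    \<comment> \<open>Two factors of size \<mu> face only one power of \<zeta>, so \<open>pm\<close>
      does not suffice here. The characteristic equation \<open>ce\<close> trades the whole product
      for \<open>weyl 0\<close> times a bounded factor.\<close>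
    also have "\<dots> = cmod (\<mu> - ?\<nu>) * cmod (\<mu> + ?\<nu>) * ?r * real i / ?a" by simp
    also have "\<dots> = cmod (of_real ?b + of_real ?a * \<zeta>) / ?a * real i * cmod (weyl 0)"
      unfolding ce by simp
    also have "\<dots> \<le> 2 * d / (?a - ?b) * real m * cmod (weyl 0)"
    proof -
      have "cmod (of_real ?b + of_real ?a * \<zeta>) \<le> 2 * d" using n1(2) ab_d d by linarith
      then have "cmod (of_real ?b + of_real ?a * \<zeta>) / ?a \<le> 2 * d / (?a - ?b)"
        by (intro frac_le) (use pos lt d in auto)
      then show ?thesis
        unfolding mM using pos dK by (intro mult_right_mono mult_mono) auto
    qed
    finally show ?thesis .
  next
    fix i j assume mM: "m = Suc (2 * i)" "M = 2 * j"
    then have "Suc i \<le> j" using \<open>m \<le> M\<close> by presburger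
    then obtain e where j: "j = Suc i + e" using le_Suc_ex by blast
    have "cmod (dirichlet m) * cmod (weyl M) * \<rho> ^ (M - m)
        = ?r ^ i * cmod (dirichlet (Suc (2 * i))) * cmod (weyl 0) * ((\<rho> * ?r) * (?r * \<rho>\<^sup>2) ^ e)"
    proof -
      have "M - m = Suc (2 * e)" by (simp add: mM j)
      then show ?thesis
        unfolding mM j weyl_even weyl_0
        by (simp add: norm_mult norm_power power_add power_mult_distrib power_mult[symmetric] mult_ac)
    qed
    also have "\<dots> \<le> real m * cmod (weyl 0) * (1 * 1)"
      unfolding mM using r pw rho rho_r odd_le by (intro mult_mono) auto
    also have "\<dots> \<le> 2 * d / (?a - ?b) * (real m * cmod (weyl 0))"
      using dK mult_right_mono[of 1 "2 * d / (?a - ?b)" "real m * cmod (weyl 0)"] by simp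
    finally show ?thesis by (simp add: mult.assoc)
  next
    fix i j assume mM: "m = Suc (2 * i)" "M = Suc (2 * j)"
    then obtain e where j: "j = i + e" using \<open>m \<le> M\<close> le_Suc_ex by auto
    have "cmod (dirichlet m) * cmod (weyl M) * \<rho> ^ (M - m)
        = ?r ^ i * cmod (dirichlet (Suc (2 * i))) * (cmod (\<mu> + ?\<nu>) * ?r) * (?r * \<rho>\<^sup>2) ^ e"
      unfolding mM j weyl_odd mu_b2
      by (simp add: norm_mult norm_power power_add power_mult_distrib power_mult[symmetric] mult_ac)
    also have "\<dots> \<le> real m * (2 * d) * 1"
      unfolding mM by (rule mult_mono[OF mult_mono[OF odd_le pm(2)] pw]) (use r rr d in auto)
    \<comment> \<open>No factor \<open>weyl 0\<close> has appeared in this case; it is introduced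
      through its lower bound, whence the difference \<open>a0 1 - a0 2\<close> in the
      constant.\<close>
    also have "\<dots> = 2 * d / (?a - ?b) * real m * (?a - ?b)"
      using lt by simp
    also have "\<dots> \<le> 2 * d / (?a - ?b) * real m * cmod (weyl 0)"
      using w0 lt d by (intro mult_left_mono) auto
    finally show ?thesis .
  qed
qed

text \<open>
  Here \<open>\<rho>\<close> absorbs an exponential growth of \<open>y\<close> that is slower than the decay of the Weyl
  solution; the Green function turns the weighted supremum of \<open>y\<close> into a contraction.
\<close>

lemma perturbed_solution_eq_zero:
  assumes w0: "weyl 0 \<noteq> 0" and rho1: "\<rho> \<ge> 1" and rho_zeta: "\<rho>\<^sup>2 * cmod \<zeta> < 1" and zeta: "cmod \<zeta> < 1"
    and growth: "\<And>n. cmod (y n) \<le> C * \<rho> ^ n" and y0: "y 0 = 0"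
    and res: "\<And>n. residual \<mu> y n = f (Suc n)"
    and f: "\<And>n B. (\<And>k. cmod (y k) \<le> B * \<rho> ^ k) \<Longrightarrow> cmod (f n) \<le> \<delta> n * (B * \<rho> ^ n)"
    and kernel: "\<And>m M. m \<le> M \<Longrightarrow>
       cmod (dirichlet m) * cmod (weyl M) * \<rho> ^ (M - m) \<le> K * a0 2 * real m * cmod (weyl 0)"
    and K: "K \<ge> 0" and delta: "\<And>n. \<delta> n \<ge> 0"
    and summ: "summable (\<lambda>m. real (Suc m) * \<delta> (Suc m))"
    and small: "K * (\<Sum>m. real (Suc m) * \<delta> (Suc m)) < 1"
  shows "y n = 0"
proof -
  let ?X = "\<Sum>m. real (Suc m) * \<delta> (Suc m)"
  have a2: "a0 2 > 0" using a0_pos' .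
  have rho: "\<rho> > 0" using rho1 by simp
  define B where "B = (SUP n. cmod (y n) / \<rho> ^ n)"
  have bdd: "bdd_above (range (\<lambda>n. cmod (y n) / \<rho> ^ n))"
    using growth rho by (intro bdd_aboveI[of _ C]) (auto simp: pos_divide_le_eq)
  have yB: "cmod (y n) \<le> B * \<rho> ^ n" for n
  proof -
    have "cmod (y n) / \<rho> ^ n \<le> B"
      unfolding B_def by (rule cSUP_upper[OF _ bdd]) simp
    then show ?thesis using rho by (simp add: pos_divide_le_eq)
  qed
  have B: "B \<ge> 0" using yB[of 0] y0 by simp
  have fB: "cmod (f n) \<le> \<delta> n * (B * \<rho> ^ n)" for n
    using f yB by blast
  define T where "T n = of_real (a0 n) * (weyl n * y (Suc n) - weyl (Suc n) * y n)" for n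
  have T_sum: "T N = T n + (\<Sum>k\<in>{n<..N}. weyl k * f k)" if "n \<le> N" for n N
  proof -
    have "{1..N} = {1..n} \<union> {n<..N}" using that by auto
    then have "(\<Sum>k=1..N. weyl k * f k) = (\<Sum>k=1..n. weyl k * f k) + (\<Sum>k\<in>{n<..N}. weyl k * f k)"
      by (simp add: sum.union_disjoint ivl_disj_int)
    then show ?thesis
      using wronskian_sum[of \<mu> weyl y f N] wronskian_sum[of \<mu> weyl y f n] residual_weyl res
      by (simp add: T_def)
  qed
  \<comment> \<open>The decay rate of the Weyl solution beats the growth rate \<rho> of
    \<open>y\<close>, so the boundary term at infinity disappears.\<close>
  have T_lim: "T \<longlonglongrightarrow> 0"
  proof -
    let ?q = "sqrt (cmod \<zeta>)"
    obtain D where D: "D \<ge> 0" "\<And>n. cmod (weyl n) \<le> D * ?q ^ n"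
      using norm_weyl_le[OF zeta] by auto
    have "sqrt (\<rho>\<^sup>2 * cmod \<zeta>) < 1" using rho_zeta by simp
    then have qr: "?q * \<rho> < 1" "0 \<le> ?q * \<rho>" using rho by (simp_all add: real_sqrt_mult mult.commute)
    let ?A = "max (a0 1) (a0 2)"
    have bound: "norm (T n) \<le> ?A * (D * B * \<rho> + D * ?q * B) * (?q * \<rho>) ^ n" for n
    proof -
      have "cmod (weyl n * y (Suc n)) \<le> (D * ?q ^ n) * (B * \<rho> ^ Suc n)"
        unfolding norm_mult using rho D by (intro mult_mono D yB) auto
      moreover have "cmod (weyl (Suc n) * y n) \<le> (D * ?q ^ Suc n) * (B * \<rho> ^ n)"
        unfolding norm_mult using rho D by (intro mult_mono D yB) auto
      ultimately have "cmod (weyl n * y (Suc n) - weyl (Suc n) * y n) \<le> (D * ?q ^ n) * (B * \<rho> ^ Suc n) + (D * ?q ^ Suc n) * (B * \<rho> ^ n)"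
        using norm_triangle_ineq4 order_trans by (meson add_mono)
      also have "\<dots> = (D * B * \<rho> + D * ?q * B) * (?q * \<rho>) ^ n"
        by (simp add: power_mult_distrib algebra_simps)
      finally have *: "cmod (weyl n * y (Suc n) - weyl (Suc n) * y n) \<le> (D * B * \<rho> + D * ?q * B) * (?q * \<rho>) ^ n" .
      have "a0 n \<le> ?A" using a0_cases[of n] by auto
      then have "a0 n * cmod (weyl n * y (Suc n) - weyl (Suc n) * y n) \<le> ?A * ((D * B * \<rho> + D * ?q * B) * (?q * \<rho>) ^ n)"
        using a2 by (intro mult_mono *) auto
      then show ?thesis using a0_pos'[of n] by (simp add: T_def norm_mult mult.assoc)
    qed
    have "(\<lambda>n. ?A * (D * B * \<rho> + D * ?q * B) * (?q * \<rho>) ^ n) \<longlonglongrightarrow> ?A * (D * B * \<rho> + D * ?q * B) * 0"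
      using qr by (intro tendsto_intros LIMSEQ_realpow_zero)
    then show ?thesis
      by (intro tendsto_norm_zero_cancel[OF tendsto_sandwich[OF _ _ tendsto_const[of 0], of "\<lambda>n. norm (T n)"]])
        (use bound in auto)
  qed
  have yn: "cmod (y n) \<le> K * ?X * B * \<rho> ^ n" for n
  proof -
    let ?c = "a0 2 * cmod (weyl 0)"
    have c: "?c > 0" using a2 w0 by simp
    have term_le: "cmod (dirichlet (min n k)) * cmod (weyl (max n k)) * cmod (f k)
        \<le> K * ?c * B * \<rho> ^ n * (real k * \<delta> k)" for k
    proof -
      let ?g = "cmod (dirichlet (min n k)) * cmod (weyl (max n k))"
      have g: "?g * \<rho> ^ (max n k - min n k) \<le> K * a0 2 * real (min n k) * cmod (weyl 0)"
        by (rule kernel) simp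
      \<comment> \<open>From k \<le> |n - k| + n the weight moves from \<open>k\<close> to
        \<open>n\<close>; bounding min(n, k) by \<open>k\<close> produces the first moment in the
        smallness condition.\<close>
      have grow: "?g * \<rho> ^ k \<le> K * a0 2 * real k * cmod (weyl 0) * \<rho> ^ n"
      proof -
        have "?g * \<rho> ^ k \<le> ?g * \<rho> ^ (max n k - min n k + n)"
          using rho1 by (intro mult_left_mono power_increasing) auto
        also have "\<dots> = ?g * \<rho> ^ (max n k - min n k) * \<rho> ^ n"
          by (simp only: power_add mult.assoc)
        also have "\<dots> \<le> K * a0 2 * real (min n k) * cmod (weyl 0) * \<rho> ^ n"
          using rho by (intro mult_right_mono g) auto
        also have "\<dots> \<le> K * a0 2 * real k * cmod (weyl 0) * \<rho> ^ n"
          using rho K a2 by (intro mult_right_mono mult_left_mono) auto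
        finally show ?thesis .
      qed
      have "?g * cmod (f k) \<le> ?g * (\<delta> k * (B * \<rho> ^ k))"
        by (intro mult_left_mono fB) simp
      also have "\<dots> = \<delta> k * B * (?g * \<rho> ^ k)" by simp
      also have "\<dots> \<le> \<delta> k * B * (K * a0 2 * real k * cmod (weyl 0) * \<rho> ^ n)"
        using B delta by (intro mult_left_mono grow) auto
      finally show ?thesis by (simp add: mult_ac)
    qed
    have main: "?c * cmod (y n) \<le> cmod (dirichlet n) * cmod (T N) + K * ?c * B * \<rho> ^ n * ?X" if "n \<le> N" for N
    proof -
      let ?S = "\<Sum>k=1..n. dirichlet k * f k"
      have P: "of_real (a0 n) * (dirichlet n * y (Suc n) - dirichlet (Suc n) * y n) = ?S"
        using wronskian_sum[of \<mu> dirichlet y f n] residual_dirichlet res y0 by simp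
      \<comment> \<open>Eliminate \<open>y (Suc n)\<close> between the Wronskians of
        \<open>y\<close> with p and with \<phi>.\<close>
      have "- (of_real (a0 2) * weyl 0) * y n = weyl n * ?S - dirichlet n * T n"
        unfolding P[symmetric] T_def mult_minus_left
        using wronskian_dirichlet_weyl[of n] by algebra
      also have "\<dots> = weyl n * ?S + dirichlet n * (\<Sum>k\<in>{n<..N}. weyl k * f k) - dirichlet n * T N"
        unfolding T_sum[OF that] by (simp add: algebra_simps)
      also have "weyl n * ?S = (\<Sum>k=1..n. dirichlet (min n k) * weyl (max n k) * f k)"
        unfolding sum_distrib_left by (intro sum.cong) (auto simp: min_def max_def)
      also have "dirichlet n * (\<Sum>k\<in>{n<..N}. weyl k * f k) = (\<Sum>k\<in>{n<..N}. dirichlet (min n k) * weyl (max n k) * f k)"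
        unfolding sum_distrib_left by (intro sum.cong) (auto simp: min_def max_def)
      also have "(\<Sum>k=1..n. dirichlet (min n k) * weyl (max n k) * f k) + (\<Sum>k\<in>{n<..N}. dirichlet (min n k) * weyl (max n k) * f k)
         = (\<Sum>k=1..N. dirichlet (min n k) * weyl (max n k) * f k)"
      proof -
        have "{1..N} = {1..n} \<union> {n<..N}" using that by auto
        then show ?thesis by (simp add: sum.union_disjoint ivl_disj_int)
      qed
      finally have "cmod (- (of_real (a0 2) * weyl 0) * y n)
          = cmod ((\<Sum>k=1..N. dirichlet (min n k) * weyl (max n k) * f k) - dirichlet n * T N)"
        by (rule arg_cong)
      moreover have "?c * cmod (y n) = cmod (- (of_real (a0 2) * weyl 0) * y n)"
        using a2 by (simp add: norm_mult)
      ultimately have "?c * cmod (y n)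
          = cmod ((\<Sum>k=1..N. dirichlet (min n k) * weyl (max n k) * f k) - dirichlet n * T N)"
        by simp
      also have "\<dots> \<le> (\<Sum>k=1..N. cmod (dirichlet (min n k) * weyl (max n k) * f k)) + cmod (dirichlet n) * cmod (T N)"
        unfolding norm_mult[of "dirichlet n", symmetric]
        by (rule order_trans[OF norm_triangle_ineq4 add_right_mono[OF norm_sum]])
      also have "(\<Sum>k=1..N. cmod (dirichlet (min n k) * weyl (max n k) * f k))
          \<le> (\<Sum>k=1..N. K * ?c * B * \<rho> ^ n * (real k * \<delta> k))"
        using term_le by (intro sum_mono) (simp add: norm_mult)
      also have "\<dots> = K * ?c * B * \<rho> ^ n * (\<Sum>k=1..N. real k * \<delta> k)"
        by (simp add: sum_distrib_left)
      also have "(\<Sum>k=1..N. real k * \<delta> k) = (\<Sum>m<N. real (Suc m) * \<delta> (Suc m))"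
        by (rule sum.reindex_bij_witness[of _ Suc "\<lambda>k. k - 1"]) auto
      also have "K * ?c * B * \<rho> ^ n * \<dots> \<le> K * ?c * B * \<rho> ^ n * ?X"
        using summ delta K B rho c by (intro mult_left_mono sum_le_suminf) auto
      finally show ?thesis by simp
    qed
    have "(\<lambda>N. cmod (dirichlet n) * cmod (T N) + K * ?c * B * \<rho> ^ n * ?X)
        \<longlonglongrightarrow> cmod (dirichlet n) * 0 + K * ?c * B * \<rho> ^ n * ?X"
      by (intro tendsto_intros tendsto_norm_zero T_lim)
    then have "?c * cmod (y n) \<le> cmod (dirichlet n) * 0 + K * ?c * B * \<rho> ^ n * ?X"
      by (rule tendsto_lowerbound) (use main in \<open>auto simp: eventually_sequentially\<close>)
    then have "?c * cmod (y n) \<le> ?c * (K * ?X * B * \<rho> ^ n)" by (simp add: mult_ac)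
    then show ?thesis using c by (rule mult_left_le_imp_le)
  qed
  have "B \<le> K * ?X * B"
    unfolding B_def
  proof (rule cSUP_least)
    show "cmod (y n) / \<rho> ^ n \<le> K * ?X * (SUP n. cmod (y n) / \<rho> ^ n)" for n
      using yn[of n] rho by (simp add: B_def pos_divide_le_eq)
  qed simp
  then have "(1 - K * ?X) * B \<le> 0" by (simp add: algebra_simps)
  then have "B = 0" using small B by (simp add: mult_le_0_iff)
  then show ?thesis using yB[of n] by simp
qed

end

section \<open>Growth of the gauge, compactness, and the constant\<close>

lemma eventually_ratio_bound_imp_power_bound:
  fixes u :: "nat \<Rightarrow> real"
  assumes u: "\<And>n. u n \<ge> 0" and rho: "\<rho> > 0" and ev: "eventually (\<lambda>n. u (Suc n) \<le> \<rho> * u n) sequentially"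
  shows "\<exists>C. \<forall>n. u n \<le> C * \<rho> ^ n"
proof -
  obtain N where N: "\<And>n. n \<ge> N \<Longrightarrow> u (Suc n) \<le> \<rho> * u n"
    using ev by (auto simp: eventually_sequentially)
  define C where "C = (\<Sum>k\<le>N. u k / \<rho> ^ k)"
  have C: "u k / \<rho> ^ k \<le> C" if "k \<le> N" for k
    unfolding C_def using u rho that by (intro member_le_sum) auto
  have "u n \<le> C * \<rho> ^ n" for n
  proof (induction n)
    case 0
    then show ?case using C[of 0] by simp
  next
    case (Suc n)
    show ?case
    proof (cases "Suc n \<le> N")
      case True
      then show ?thesis using C[of "Suc n"] rho by (simp add: pos_divide_le_eq)
    next
      case False
      then have "u (Suc n) \<le> \<rho> * u n" using N by simp
      also have "\<dots> \<le> \<rho> * (C * \<rho> ^ n)" using Suc.IH rho by (intro mult_left_mono) auto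
      finally show ?thesis by (simp add: mult_ac)
    qed
  qed
  then show ?thesis by blast
qed

text \<open>If the entries stayed away from 0 along a subsequence, compactness would make a further
  subsequence of the columns converge in norm to some \<open>z\<close>. Their entries are then close
  to values of \<open>z\<close> at indices tending to infinity, and these tend to 0.\<close>

lemma compact_operator_superdiagonal_tendsto_0:
  assumes "compact_operator_ell2 T"
  shows "(\<lambda>n. T (\<lambda>k. if k = Suc n then 1 else 0) n) \<longlonglongrightarrow> 0"
proof (rule ccontr)
  let ?e = "\<lambda>n k. if k = Suc n then 1 else (0 :: complex)"
  assume "\<not> (\<lambda>n. T (?e n) n) \<longlonglongrightarrow> 0"
  then obtain \<epsilon> where eps: "\<epsilon> > 0" "\<And>N. \<exists>n\<ge>N. \<epsilon> \<le> cmod (T (?e n) n)"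
    unfolding lim_sequentially by (auto simp: not_less)
  then obtain g where g: "\<And>N. g N \<ge> N" "\<And>N. \<epsilon> \<le> cmod (T (?e (g N)) (g N))"
    by metis
  have e: "?e n \<in> ell2" for n by (rule ell2_finite_support[of _ "Suc (Suc n)"]) auto
  have "ell2_norm (?e n) = 1" for n
  proof -
    have "(\<lambda>k. (cmod (?e n k))\<^sup>2) = (\<lambda>k. if k = Suc n then 1 else 0)" by auto
    then show ?thesis
      unfolding ell2_norm_def using sums_unique[OF sums_single[of "Suc n" "\<lambda>_. 1::real"]] by simp
  qed
  then obtain z r where z: "z \<in> ell2" and r: "strict_mono (r :: nat \<Rightarrow> nat)"
    and lim: "(\<lambda>k. ell2_norm (\<lambda>n. T (?e (g (r k))) n - z n)) \<longlonglongrightarrow> 0"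
  proof -
    have "\<forall>X. (\<forall>k. X k \<in> ell2 \<and> ell2_norm (X k) \<le> 1) \<longrightarrow>
        (\<exists>z\<in>ell2. \<exists>r :: nat \<Rightarrow> nat. strict_mono r \<and> (\<lambda>k. ell2_norm (\<lambda>n. T (X (r k)) n - z n)) \<longlonglongrightarrow> 0)"
      using assms by (simp add: compact_operator_ell2_def)
    from this[rule_format, of "\<lambda>k. ?e (g k)"] show ?thesis
      using e \<open>\<And>n. ell2_norm (?e n) = 1\<close> that by fastforce
  qed
  have gr: "filterlim (\<lambda>k. g (r k)) at_top sequentially"
  proof (rule filterlim_at_top_mono[OF filterlim_ident])
    show "eventually (\<lambda>k. k \<le> g (r k)) sequentially"
      using g(1) seq_suble[OF r] order_trans by (intro always_eventually allI) blast
  qed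
  have "(\<lambda>k. z (g (r k))) \<longlonglongrightarrow> 0"
    using filterlim_compose[OF ell2_tendsto_zero[OF z] gr] .
  then have "(\<lambda>k. ell2_norm (\<lambda>n. T (?e (g (r k))) n - z n) + cmod (z (g (r k)))) \<longlonglongrightarrow> 0 + 0"
    by (intro tendsto_add lim tendsto_norm_zero)
  moreover have "\<epsilon> \<le> ell2_norm (\<lambda>n. T (?e (g (r k))) n - z n) + cmod (z (g (r k)))" for k
  proof -
    let ?m = "g (r k)"
    have "(\<lambda>n. T (?e ?m) n - z n) \<in> ell2"
      using assms e z by (intro ell2_diff) (auto simp: compact_operator_ell2_def)
    then have "cmod (T (?e ?m) ?m - z ?m) \<le> ell2_norm (\<lambda>n. T (?e ?m) n - z n)"
      by (rule norm_le_ell2_norm)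
    then show ?thesis
      using g(2)[of "r k"] norm_triangle_ineq[of "T (?e ?m) ?m - z ?m" "z ?m"] by simp
  qed
  ultimately have "\<epsilon> \<le> 0 + 0"
    by (intro tendsto_lowerbound[of _ _ sequentially]) auto
  with eps show False by simp
qed

text \<open>By \<open>prod\<close> the left-hand side is 8 d / (d^2 - s^2) divided by
  \<open>1 - a\<^sub>2 / a\<^sub>1\<close>. One root of d^2 - s^2 is kept, the other is at least d -
  s, and d / (d - s) \<ge> 1 may be raised to the fifth power.\<close>

lemma perturbation_constant_le:
  fixes a\<^sub>1 a\<^sub>2 d s :: real
  assumes "0 < a\<^sub>2" "a\<^sub>2 < a\<^sub>1" "0 < s" "s < d" and prod: "d\<^sup>2 - s\<^sup>2 = 4 * (a\<^sub>1 * a\<^sub>2)"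
  shows "2 * d / (a\<^sub>2 * (a\<^sub>1 - a\<^sub>2)) \<le> K2 s d / (1 - a\<^sub>2 / a\<^sub>1)"
proof -
  let ?R = "sqrt (d\<^sup>2 - s\<^sup>2)"
  have "s\<^sup>2 < d\<^sup>2" using assms by (intro power_strict_mono) auto
  then have R: "?R > 0" "?R * ?R = d\<^sup>2 - s\<^sup>2" by simp_all
  have "(d - s)\<^sup>2 \<le> d\<^sup>2 - s\<^sup>2"
    using assms mult_strict_left_mono[of s d s] by (simp add: power2_eq_square algebra_simps)
  then have "d - s \<le> ?R" by (rule real_le_rsqrt)
  have q: "1 \<le> d / (d - s)" using assms by simp
  have "8 * d / (?R * ?R) = 8 / ?R * (d / ?R)" by simp
  then have "8 * d / (d\<^sup>2 - s\<^sup>2) = 8 / ?R * (d / ?R)" by (simp only: R(2))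
  also have "\<dots> \<le> 8 / ?R * (d / (d - s))"
    using assms R \<open>d - s \<le> ?R\<close> by (intro mult_left_mono divide_left_mono) auto
  also have "\<dots> \<le> 8 / ?R * (d / (d - s)) ^ 5"
    using R q power_increasing[of 1 5 "d / (d - s)"] by (intro mult_left_mono) auto
  also have "\<dots> \<le> 1024 * sqrt 2 / ?R * (d / (d - s)) ^ 5"
  proof -
    have "sqrt 2 \<ge> (1::real)" by simp
    then have "8 \<le> 1024 * sqrt (2::real)" by linarith
    then show ?thesis
      using R q by (intro mult_right_mono divide_right_mono) auto
  qed
  also have "\<dots> = K2 s d" by (simp add: K2_def power_divide)
  finally have "8 * d / (d\<^sup>2 - s\<^sup>2) / (1 - a\<^sub>2 / a\<^sub>1) \<le> K2 s d / (1 - a\<^sub>2 / a\<^sub>1)"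
    using assms by (intro divide_right_mono) auto
  moreover have "8 * d / (d\<^sup>2 - s\<^sup>2) / (1 - a\<^sub>2 / a\<^sub>1) = 2 * d / (a\<^sub>2 * (a\<^sub>1 - a\<^sub>2))"
    unfolding prod using assms by (simp add: divide_simps)
  ultimately show ?thesis by simp
qed

section \<open>Absence of discrete spectrum\<close>

theorem theorem1p2:
  fixes a0 b0 :: "nat \<Rightarrow> real" and a b c :: "nat \<Rightarrow> complex" and s d t \<nu> :: real
  assumes a0_pos: "\<And>n. n \<ge> 1 \<Longrightarrow> a0 n > 0"
    and a0_periodic: "\<And>n. n \<ge> 1 \<Longrightarrow> a0 (n + 2) = a0 n"
    and b0_periodic: "\<And>n. n \<ge> 1 \<Longrightarrow> b0 (n + 2) = b0 n"
    and a0_zero: "a0 0 = a0 2"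
    and s_d: "0 < s" "s < d"
    and cont_spec: "continuous_spectrum (real_jacobi_op a0 b0) = of_real ` ({-d..-s} \<union> {s..d})"
    and ac_nonzero: "\<And>n. n \<ge> 1 \<Longrightarrow> a n * c n \<noteq> 0"
    and ac_zero: "a 0 = of_real (a0 0)" "c 0 = of_real (a0 0)"
    and compact_pert: "compact_operator_ell2 (\<lambda>y n. jacobi_op a b c y n - real_jacobi_op a0 b0 y n)"
    and no_eigenvalues: "eigenvalues (real_jacobi_op a0 b0) = {}"
    and a0_neq: "\<And>n. n \<ge> 1 \<Longrightarrow> a0 n \<noteq> a0 (n + 1)"
    and nu: "\<nu> = b0 1"
    and t: "t > 0" "t * exp t = 1"
    and summable: "summable (\<lambda>m. real (Suc m) * perturbation_size a0 b0 a b c (Suc m))"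
    and small: "K2 s d / (1 - cmod (w_sq s d (of_real \<nu>))) *
                  (\<Sum>m. real (Suc m) * perturbation_size a0 b0 a b c (Suc m)) < t"
  shows "discrete_spectrum (real_jacobi_op a0 b0) (jacobi_op a b c) = {}"
proof -
  interpret periodic_jacobi a0 b0
    using a0_pos a0_periodic b0_periodic a0_zero by unfold_locales
  have neq: "a0 1 \<noteq> a0 2" using a0_neq[of 1] by (simp add: numeral_2_eq_2)
  note b2 = band_edges(1)[OF no_eigenvalues neq s_d cont_spec]
    and d_eq = band_edges(2)[OF no_eigenvalues neq s_d cont_spec]
    and s_eq = band_edges(3)[OF no_eigenvalues neq s_d cont_spec]
  have lt: "a0 2 < a0 1" by (rule a0_decreasing[OF no_eigenvalues neq])
  have pos: "a0 1 > 0" "a0 2 > 0" using a0_pos' by auto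
  let ?\<delta> = "perturbation_size a0 b0 a b c"
  \<comment> \<open>The kernel constant \<open>2 * d / (a0 1 - a0 2)\<close> divided by the factor
    \<open>a0 2\<close> of the Green function denominator.\<close>
  define K where "K = 2 * d / (a0 2 * (a0 1 - a0 2))"
  have K: "K \<ge> 0" using lt pos s_d by (simp add: K_def)
  have delta: "?\<delta> n \<ge> 0" for n by (simp add: perturbation_size_def)
  have "t < 1"
  proof (rule ccontr)
    assume "\<not> t < 1"
    then have "1 * 1 < t * exp t" by (intro mult_le_less_imp_less) auto
    then show False using t by simp
  qed
  have small': "K * (\<Sum>m. real (Suc m) * ?\<delta> (Suc m)) < 1"
  proof -
    have "cmod (w_sq s d (of_real \<nu>)) = a0 2 / a0 1"
      unfolding nu w_sq_at_b0[OF lt d_eq s_eq] using pos by (simp add: norm_divide)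
    moreover have "d\<^sup>2 - s\<^sup>2 = 4 * (a0 1 * a0 2)"
      unfolding d_eq s_eq by (simp add: power2_sum power2_diff)
    then have "K \<le> K2 s d / (1 - a0 2 / a0 1)"
      unfolding K_def by (rule perturbation_constant_le[OF pos(2) lt s_d])
    then have "K * (\<Sum>m. real (Suc m) * ?\<delta> (Suc m)) \<le> K2 s d / (1 - a0 2 / a0 1) * (\<Sum>m. real (Suc m) * ?\<delta> (Suc m))"
      using summable delta by (intro mult_right_mono suminf_nonneg) auto
    ultimately show ?thesis using small \<open>t < 1\<close> by simp
  qed
  have False if ev: "\<mu> \<in> eigenvalues (jacobi_op a b c)" and ncs: "\<mu> \<notin> continuous_spectrum (real_jacobi_op a0 b0)" for \<mu>
  proof -
    obtain y where y: "y \<in> ell2" "y \<noteq> (\<lambda>n. 0)" "jacobi_op a b c y = (\<lambda>n. \<mu> * y n)"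
      using ev by (auto simp: eigenvalues_def)
    have y0: "y 0 = 0" using y(1) by (simp add: ell2_def)
    obtain \<zeta> where zeta_le: "cmod \<zeta> \<le> 1" and fl: "floquet a0 b0 \<mu> \<zeta>"
      using ex_floquet by blast
    interpret floquet a0 b0 \<mu> \<zeta> by fact
    have zeta: "cmod \<zeta> < 1"
      using unit_multiplier_imp_continuous_spectrum[OF no_eigenvalues] ncs zeta_le by force
    have w0: "weyl 0 \<noteq> 0" using weyl_0_ge[OF fl zeta_le] lt by auto
    \<comment> \<open>\<rho>^2 is the midpoint of 1 and 1/|\<zeta>|, hence both \<rho> > 1 and
      \<rho>^2 |\<zeta>| < 1.\<close>
    define \<rho> where "\<rho> = sqrt ((1 + 1 / cmod \<zeta>) / 2)"
    have "1 / cmod \<zeta> > 1" using zeta zeta_nz by simp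
    then have rho: "\<rho> > 1" by (simp add: \<rho>_def)
    have "\<rho>\<^sup>2 = (1 + 1 / cmod \<zeta>) / 2" using \<open>1 / cmod \<zeta> > 1\<close> by (simp add: \<rho>_def)
    then have "\<rho>\<^sup>2 * cmod \<zeta> = (cmod \<zeta> + 1) / 2"
      using zeta_nz by (simp add: field_simps)
    then have rho_zeta: "\<rho>\<^sup>2 * cmod \<zeta> < 1" using zeta by simp
    \<comment> \<open>A diagonal gauge that turns the upper diagonal \<open>c\<close> into \<open>a0\<close>; it need not preserve \<open>ell2\<close>,
      but it grows more slowly than any exponential because \<open>c n - a0 n \<longlonglongrightarrow> 0\<close>.\<close>
    define g where "g n = (\<Prod>k=1..<n. c k / of_real (a0 k))" for n
    have g_Suc: "g (Suc n) = g n * (c n / of_real (a0 n))" if "n \<ge> 1" for n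
      using that by (simp add: g_def)
    have c_nz: "c n \<noteq> 0" if "n \<ge> 1" for n using ac_nonzero[OF that] by auto
    have g_nz: "g n \<noteq> 0" for n unfolding g_def using c_nz a0_nz by auto
    have c_lim: "(\<lambda>n. c n - of_real (a0 n)) \<longlonglongrightarrow> 0"
    proof (rule Lim_transform_eventually[OF compact_operator_superdiagonal_tendsto_0[OF compact_pert]])
      show "eventually (\<lambda>n. jacobi_op a b c (\<lambda>k. if k = Suc n then 1 else 0) n
          - real_jacobi_op a0 b0 (\<lambda>k. if k = Suc n then 1 else 0) n = c n - of_real (a0 n)) sequentially"
        using eventually_ge_at_top[of 1]
        by eventually_elim (auto simp: real_jacobi_op_def jacobi_op_def)
    qed
    have "eventually (\<lambda>n. cmod (g (Suc n)) \<le> \<rho> * cmod (g n)) sequentially"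
    proof -
      have "(\<rho> - 1) * a0 2 > 0" using rho pos by simp
      then have "eventually (\<lambda>n. cmod (c n - of_real (a0 n)) < (\<rho> - 1) * a0 2) sequentially"
        using tendstoD[OF c_lim] by simp
      then show ?thesis using eventually_ge_at_top[of 1]
      proof eventually_elim
        case (elim n)
        have "a0 2 \<le> a0 n" using a0_cases[of n] lt by auto
        then have "(\<rho> - 1) * a0 2 \<le> (\<rho> - 1) * a0 n" using rho by simp
        moreover have "cmod (c n) \<le> cmod (c n - of_real (a0 n)) + a0 n"
          using norm_triangle_ineq[of "c n - of_real (a0 n)" "of_real (a0 n)"] a0_pos'[of n] by simp
        ultimately have "cmod (c n) \<le> \<rho> * a0 n" using elim by (simp add: algebra_simps)
        then have "cmod (c n / of_real (a0 n)) \<le> \<rho>"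
          using a0_pos'[of n] by (simp add: norm_divide pos_divide_le_eq)
        then show ?case
          unfolding g_Suc[OF elim(2)] norm_mult mult.commute[of "cmod (g n)"]
          by (rule mult_right_mono) simp
      qed
    qed
    then obtain C where C: "\<And>n. cmod (g n) \<le> C * \<rho> ^ n"
      using eventually_ratio_bound_imp_power_bound[of "\<lambda>n. cmod (g n)" \<rho>] rho by auto
    define v where "v n = g n * y n" for n
    \<comment> \<open>\<alpha> and \<beta> are the coefficient differences after the gauge, exactly
      the two terms of \<open>perturbation_size\<close>. At index 0 truncated subtraction reads
      \<open>n - 1\<close> as 0, so the bound on \<open>f\<close> holds there as well.\<close>
    define \<alpha> where "\<alpha> n = of_real (a0 n) - a n * c n / of_real (a0 n)" for n
    define \<beta> where "\<beta> n = of_real (b0 n) - b n" for n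
    define f where "f n = \<alpha> (n - 1) * v (n - 1) + \<beta> n * v n" for n
    have delta_eq: "?\<delta> n = cmod (\<beta> n) + cmod (\<alpha> (n - 1))" for n
      by (simp add: perturbation_size_def \<alpha>_def \<beta>_def)
    have v_zero: "v n = 0" for n
    proof (rule perturbed_solution_eq_zero[where f=f and \<delta>="?\<delta>" and K=K and \<rho>=\<rho> and C="C * ell2_norm y"])
      show "cmod (v n) \<le> C * ell2_norm y * \<rho> ^ n" for n
      proof -
        have "cmod (v n) \<le> (C * \<rho> ^ n) * ell2_norm y"
          unfolding v_def norm_mult using norm_ge_zero order_trans[OF norm_ge_zero C[of n]]
          by (intro mult_mono C norm_le_ell2_norm y) auto
        then show ?thesis by (simp add: mult_ac)
      qed
      show "v 0 = 0" by (simp add: v_def y0)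
      show "residual \<mu> v n = f (Suc n)" for n
      proof -
        have e: "a n * y n + b (Suc n) * y (Suc n) + c (Suc n) * y (Suc (Suc n)) = \<mu> * y (Suc n)"
          using fun_cong[OF y(3), of "Suc n"] by (simp add: jacobi_op_def)
        have e': "c (Suc n) * y (Suc (Suc n)) = (\<mu> - b (Suc n)) * y (Suc n) - a n * y n"
          using e by (simp add: algebra_simps)
        have "of_real (a0 (Suc n)) * v (Suc (Suc n)) = g (Suc n) * (c (Suc n) * y (Suc (Suc n)))"
          unfolding v_def using g_Suc[of "Suc n"] a0_nz[of "Suc n"] by simp
        then have r: "residual \<mu> v n = of_real (a0 n) * v n - a n * y n * g (Suc n) + \<beta> (Suc n) * v (Suc n)"
          unfolding residual_def e' by (simp add: v_def \<beta>_def algebra_simps)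
        \<comment> \<open>\<open>g_Suc\<close> starts at index 1; for \<open>n = 0\<close> both
          sides vanish because \<open>y 0 = 0\<close>.\<close>
        have "a n * y n * g (Suc n) = a n * c n / of_real (a0 n) * v n"
        proof (cases "n = 0")
          case True
          then show ?thesis by (simp add: v_def y0)
        next
          case False
          then show ?thesis using g_Suc[of n] by (simp add: v_def)
        qed
        then show ?thesis unfolding r by (simp add: f_def \<alpha>_def algebra_simps)
      qed
      show "cmod (f n) \<le> ?\<delta> n * (B * \<rho> ^ n)" if B: "\<And>k. cmod (v k) \<le> B * \<rho> ^ k" for n B
      proof -
        have "B \<ge> 0" using order_trans[OF norm_ge_zero B[of 0]] by simp
        then have "B * \<rho> ^ (n - 1) \<le> B * \<rho> ^ n"
          using rho by (intro mult_left_mono power_increasing) auto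
        then have "cmod (v (n - 1)) \<le> B * \<rho> ^ n" using B[of "n - 1"] by linarith
        then have "cmod (\<alpha> (n - 1)) * cmod (v (n - 1)) + cmod (\<beta> n) * cmod (v n)
            \<le> cmod (\<alpha> (n - 1)) * (B * \<rho> ^ n) + cmod (\<beta> n) * (B * \<rho> ^ n)"
          using B by (intro add_mono mult_left_mono) auto
        then show ?thesis
          unfolding f_def delta_eq
          using norm_triangle_ineq[of "\<alpha> (n - 1) * v (n - 1)" "\<beta> n * v n"]
          by (simp add: norm_mult distrib_right)
      qed
      show "cmod (dirichlet m) * cmod (weyl M) * \<rho> ^ (M - m) \<le> K * a0 2 * real m * cmod (weyl 0)"
        if "m \<le> M" for m M
      proof -
        have "K * a0 2 = 2 * d / (a0 1 - a0 2)" using pos by (simp add: K_def)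
        then show ?thesis
          using weighted_kernel_le[OF b2 lt _ d_eq zeta_le, of \<rho> m M] s_d rho rho_zeta that by simp
      qed
    qed (use w0 rho rho_zeta zeta K delta summable small' in auto)
    have "y = (\<lambda>n. 0)"
    proof
      show "y n = 0" for n using v_zero[of n] g_nz[of n] by (simp add: v_def)
    qed
    with y(2) show False by contradiction
  qed
  then show ?thesis by (auto simp: discrete_spectrum_def)
qed

end
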